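(* Suppose the group $G$ has a deficiency 1 presentation $\langle F_n\mid R\rangle$ (that is, $n$ generators and $n-1$ relators) where one of the relators is a commutator in $F_n$, i.e. of the form $uvu^{-1}v^{-1}$ for some $u,v\in F_n$. Then exactly one of the following occurs: (i) $G=\mathbb{Z}\times\mathbb{Z}$. (ii) $G$ is residually useless with abelianisation $\mathbb{Z}\times\mathbb{Z}$. (iii) $G$ is large. In particular, if the abelianisation of $G$ is not isomorphic to $\mathbb{Z}\times\mathbb{Z}$ then $G$ is large.
   Context: $F_n$ is the free group of rank $n$ on the generators of the presentation. A finitely generated group $G$ is large if it has a finite index subgroup possessing a surjective homomorphism onto a non-abelian free group. A finitely generated group $G$ with commutator subgroup $G'$ is residually useless if $G$ is non-abelian and $G'$ equals the intersection of all finite index subgroups of $G$. The deficiency of a finite presentation is the number of generators minus the number of relators. *)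

theory Defs
  imports "HOL-Algebra.Algebra"
begin

section \<open>Free groups\<close>

text \<open>
  A letter \<open>(a, True)\<close> is the generator \<open>a\<close> and \<open>(a, False)\<close> is its formal inverse. The free
  group is realised on the reduced words, with concatenation followed by free reduction.
\<close>

type_synonym 'a letter = "'a \<times> bool"

definition letter_inv :: "'a letter \<Rightarrow> 'a letter" where
  "letter_inv x = (fst x, \<not> snd x)"

definition reduced :: "'a letter list \<Rightarrow> bool" where
  "reduced w \<longleftrightarrow> successively (\<lambda>x y. y \<noteq> letter_inv x) w"

fun letter_mult :: "'a letter \<Rightarrow> 'a letter list \<Rightarrow> 'a letter list" where
  "letter_mult x [] = [x]"
| "letter_mult x (y # w) = (if y = letter_inv x then w else x # y # w)"

definition word_mult :: "'a letter list \<Rightarrow> 'a letter list \<Rightarrow> 'a letter list" where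
  "word_mult u v = foldr letter_mult u v"

definition free_group :: "'a set \<Rightarrow> 'a letter list monoid" where
  "free_group S = \<lparr>carrier = {w. fst ` set w \<subseteq> S \<and> reduced w}, monoid.mult = word_mult, one = []\<rparr>"

abbreviation free_group_rank :: "nat \<Rightarrow> nat letter list monoid" where
  "free_group_rank n \<equiv> free_group {..<n}"

lemma letter_inv_letter_inv [simp]: "letter_inv (letter_inv x) = x"
  by (simp add: letter_inv_def)

lemma fst_letter_inv [simp]: "fst (letter_inv x) = fst x"
  by (simp add: letter_inv_def)

lemma reduced_Nil [simp]: "reduced []"
  by (simp add: reduced_def)

lemma reduced_Cons: "reduced (x # w) \<longleftrightarrow> reduced w \<and> (w = [] \<or> hd w \<noteq> letter_inv x)"
  by (cases w) (auto simp: reduced_def)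

lemma reduced_letter_mult: "reduced w \<Longrightarrow> reduced (letter_mult x w)"
  by (cases w) (auto simp: reduced_Cons)

lemma reduced_word_mult: "reduced v \<Longrightarrow> reduced (word_mult u v)"
  unfolding word_mult_def by (induction u) (auto intro: reduced_letter_mult)

lemma letter_mult_cancel:
  "reduced w \<Longrightarrow> letter_mult x (letter_mult (letter_inv x) w) = w"
  by (cases w rule: remdups_adj.cases) (auto simp: reduced_Cons)

lemma set_letter_mult: "set (letter_mult x w) \<subseteq> insert x (set w)"
  by (cases w) auto

lemma set_word_mult: "set (word_mult u v) \<subseteq> set u \<union> set v"
  unfolding word_mult_def
  by (induction u) (use set_letter_mult in fastforce)+

lemma word_mult_letter_mult:
  assumes "reduced w"
  shows "word_mult (letter_mult x v) w = letter_mult x (word_mult v w)"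
proof (cases v)
  case (Cons y v')
  have "reduced (word_mult v' w)"
    using assms by (rule reduced_word_mult)
  then show ?thesis
    using Cons letter_mult_cancel[of "word_mult v' w" x] by (auto simp: word_mult_def)
qed (simp add: word_mult_def)

lemma word_mult_assoc:
  assumes "reduced w"
  shows "word_mult (word_mult u v) w = word_mult u (word_mult v w)"
proof (induction u)
  case (Cons x u)
  have "word_mult (word_mult (x # u) v) w = word_mult (letter_mult x (word_mult u v)) w"
    by (simp add: word_mult_def)
  also have "\<dots> = letter_mult x (word_mult u (word_mult v w))"
    using Cons word_mult_letter_mult[OF assms] by simp
  finally show ?case by (simp add: word_mult_def)
qed (simp add: word_mult_def)

lemma word_mult_Nil: "reduced u \<Longrightarrow> word_mult u [] = u"
proof (induction u)
  case (Cons x u)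
  then show ?case by (cases u) (auto simp: word_mult_def reduced_Cons)
qed (simp add: word_mult_def)

lemma word_mult_left_inverse:
  "\<exists>v. reduced v \<and> fst ` set v \<subseteq> fst ` set u \<and> word_mult v u = []" if "reduced u"
  using that
proof (induction u)
  case (Cons x u)
  then obtain v where v: "reduced v" "fst ` set v \<subseteq> fst ` set u" "word_mult v u = []"
    by (auto simp: reduced_Cons)
  let ?v = "word_mult v [letter_inv x]"
  have red: "reduced [letter_inv x]" "reduced (x # u)"
    using Cons.prems by (auto simp: reduced_Cons)
  have "word_mult ?v (x # u) = word_mult v (word_mult [letter_inv x] (x # u))"
    by (rule word_mult_assoc[OF red(2)])
  also have "word_mult [letter_inv x] (x # u) = u"
    by (simp add: word_mult_def)
  finally have "word_mult ?v (x # u) = []" using v by simp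
  moreover have "fst ` set ?v \<subseteq> fst ` set (x # u)"
    using set_word_mult[of v "[letter_inv x]"] v(2) by fastforce
  ultimately show ?case using reduced_word_mult[OF red(1)] by blast
qed (auto intro: exI[of _ "[]"] simp: word_mult_def)

lemma group_free_group: "group (free_group S)"
proof (rule groupI)
  fix u v assume "u \<in> carrier (free_group S)" "v \<in> carrier (free_group S)"
  then show "u \<otimes>\<^bsub>free_group S\<^esub> v \<in> carrier (free_group S)"
    using set_word_mult[of u v] by (fastforce simp: free_group_def reduced_word_mult)
next
  fix u assume "u \<in> carrier (free_group S)"
  then show "\<exists>v\<in>carrier (free_group S). v \<otimes>\<^bsub>free_group S\<^esub> u = \<one>\<^bsub>free_group S\<^esub>"
    using word_mult_left_inverse[of u] by (simp add: free_group_def) (meson subset_trans)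
qed (auto simp: free_group_def word_mult_assoc, auto simp: word_mult_def)


section \<open>Presentations\<close>

definition normal_closure :: "('a, 'b) monoid_scheme \<Rightarrow> 'a set \<Rightarrow> 'a set" where
  "normal_closure G A = carrier G \<inter> \<Inter>{N. N \<lhd> G \<and> A \<subseteq> N}"

text \<open>
  The relators form a list, so that a relator occurring twice is counted twice in the deficiency.
\<close>

definition presented_group :: "nat \<Rightarrow> nat letter list list \<Rightarrow> nat letter list set monoid" where
  "presented_group n R = free_group_rank n Mod normal_closure (free_group_rank n) (set R)"

definition has_presentation ::
    "('a, 'b) monoid_scheme \<Rightarrow> nat \<Rightarrow> nat letter list list \<Rightarrow> bool" where
  "has_presentation G n R \<longleftrightarrow>
     group G \<and> set R \<subseteq> carrier (free_group_rank n) \<and> G \<cong> presented_group n R"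

definition deficiency :: "nat \<Rightarrow> nat letter list list \<Rightarrow> int" where
  "deficiency n R = int n - int (length R)"

definition is_commutator :: "('a, 'b) monoid_scheme \<Rightarrow> 'a \<Rightarrow> bool" where
  "is_commutator G r \<longleftrightarrow>
     (\<exists>u\<in>carrier G. \<exists>v\<in>carrier G. r = u \<otimes>\<^bsub>G\<^esub> v \<otimes>\<^bsub>G\<^esub> inv\<^bsub>G\<^esub> u \<otimes>\<^bsub>G\<^esub> inv\<^bsub>G\<^esub> v)"

lemma normal_normal_closure:
  assumes "group G" "A \<subseteq> carrier G"
  shows "normal_closure G A \<lhd> G"
proof -
  interpret group G by fact
  have "carrier G \<lhd> G" by (simp add: normal_inv_iff subgroup_self)
  then have eq: "normal_closure G A = \<Inter>{N. N \<lhd> G \<and> A \<subseteq> N}"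
    using assms(2) by (auto simp: normal_closure_def)
  have "subgroup (normal_closure G A) G"
    unfolding eq using \<open>carrier G \<lhd> G\<close> assms(2)
    by (intro subgroups_Inter) (auto dest: normal_imp_subgroup)
  then show ?thesis
    unfolding normal_inv_iff unfolding eq by (auto simp: normal_inv_iff)
qed

lemma group_presented_group:
  assumes "set R \<subseteq> carrier (free_group_rank n)"
  shows "group (presented_group n R)"
  unfolding presented_group_def
  by (intro normal.factorgroup_is_group normal_normal_closure group_free_group assms)


section \<open>Large and residually useless groups\<close>

definition finitely_generated :: "('a, 'b) monoid_scheme \<Rightarrow> bool" where
  "finitely_generated G \<longleftrightarrow>
     group G \<and> (\<exists>A. finite A \<and> A \<subseteq> carrier G \<and> generate G A = carrier G)"

definition finite_index_subgroup :: "'a set \<Rightarrow> ('a, 'b) monoid_scheme \<Rightarrow> bool" where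
  "finite_index_subgroup H G \<longleftrightarrow> subgroup H G \<and> finite (rcosets\<^bsub>G\<^esub> H)"

text \<open>
  Finite index subgroups of a finitely generated group are finitely generated, so their free
  quotients have finite rank; hence no free group is lost by taking the bases among the sets of
  natural numbers.
\<close>

definition large :: "('a, 'b) monoid_scheme \<Rightarrow> bool" where
  "large G \<longleftrightarrow> finitely_generated G \<and>
     (\<exists>H. finite_index_subgroup H G \<and>
        (\<exists>S :: nat set. \<not> comm_group (free_group S) \<and>
           epi (G\<lparr>carrier := H\<rparr>) (free_group S) \<noteq> {}))"

definition residually_useless :: "('a, 'b) monoid_scheme \<Rightarrow> bool" where
  "residually_useless G \<longleftrightarrow> finitely_generated G \<and> \<not> comm_group G \<and>
     derived G (carrier G) = \<Inter>{H. finite_index_subgroup H G}"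

definition abelianisation :: "('a, 'b) monoid_scheme \<Rightarrow> 'a set monoid" where
  "abelianisation G = G Mod derived G (carrier G)"

end

theory Submission
  imports Defs
begin

text \<open>
  The relator \<open>[u, v]\<close> is lifted to finite covers, which are described by actions of the free group
  on finite sets; a homomorphism from a finite index subgroup is the same as a labelling of the
  edges of the Schreier graph for which all lifts of the relators have trivial label.

  Suppose that \<open>u\<close> and \<open>v\<close> lie in a subgroup of finite index \<open>d \<ge> 2\<close>. The lift of \<open>[u, v]\<close> at the
  base point is again a commutator and the sum of all its lifts vanishes in homology, so that
  counting equations yields a surjection \<open>\<chi>\<close> of this subgroup onto the integers which kills both \<open>u\<close>
  and \<open>v\<close>. In the cyclic cover of degree \<open>k\<close> given by \<open>\<chi>\<close>, there are \<open>k\<close> lifts of \<open>[u, v]\<close> which are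
  void in homology. As in the theorem of Baumslag and Pride on deficiency at least two, one cuts
  the cover open and kills all edges near the cut: this costs a number of generators independent of
  \<open>k\<close>, and for large \<open>k\<close> the result is a free product of the integers with a group of positive first
  Betti number. Hence \<open>G\<close> is large.

  Otherwise no proper subgroup of finite index contains the images of \<open>u\<close> and \<open>v\<close>. As these commute,
  all finite quotients of \<open>G\<close> are abelian, and the abelianisation, of first Betti number at least
  two, is generated by \<open>u\<close> and \<open>v\<close>, hence free abelian of rank two.
\<close>

section \<open>Integer linear systems\<close>

text \<open>Gaussian elimination of one equation and one unknown at a time, cross-multiplied so that
  no division leaves the integers.\<close>

lemma exists_nonzero_solution:
  fixes c :: "'e \<Rightarrow> 'u \<Rightarrow> int"
  assumes "finite E" "finite U" "card E < card U"
  shows "\<exists>x. (\<exists>u\<in>U. x u \<noteq> 0) \<and> (\<forall>e\<in>E. (\<Sum>u\<in>U. c e u * x u) = 0)"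
  using assms
proof (induction E arbitrary: c U rule: finite_induct)
  case empty
  then have "U \<noteq> {}" by auto
  then show ?case by (intro exI[of _ "\<lambda>_. 1"]) auto
next
  case (insert e E)
  show ?case
  proof (cases "\<forall>u\<in>U. c e u = 0")
    case True
    have "card E < card U" using insert by simp
    from insert.IH[OF insert.prems(1) this, of c] True show ?thesis by auto
  next
    case False
    then obtain z where z: "z \<in> U" "c e z \<noteq> 0" by blast
    define V where "V = U - {z}"
    define c' where "c' e' w = c e z * c e' w - c e' z * c e w" for e' w
    have fin: "finite V" and card: "card E < card V"
      using insert.prems insert.hyps z by (auto simp: V_def)
    from insert.IH[OF this, of c'] obtain x where
      x: "\<exists>u\<in>V. x u \<noteq> 0" "\<And>e. e \<in> E \<Longrightarrow> (\<Sum>u\<in>V. c' e u * x u) = 0" by blast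
    \<comment> \<open>Scaling the reduced solution by the pivot \<open>c e z\<close> makes the value
      that equation \<open>e\<close> forces on \<open>z\<close> integral.\<close>
    define y where "y w = (if w = z then - (\<Sum>w\<in>V. c e w * x w) else c e z * x w)" for w
    have split: "(\<Sum>u\<in>U. c e' u * y u) = (\<Sum>u\<in>V. c' e' u * x u)" for e'
    proof -
      have "(\<Sum>u\<in>U. c e' u * y u) = c e' z * y z + (\<Sum>u\<in>V. c e' u * y u)"
        unfolding V_def using z insert.prems by (simp add: sum.remove)
      also have "(\<Sum>u\<in>V. c e' u * y u) = (\<Sum>u\<in>V. c e' u * (c e z * x u))"
        by (intro sum.cong) (auto simp: y_def V_def)
      also have "c e' z * y z = (\<Sum>u\<in>V. - (c e' z * (c e u * x u)))"
        by (simp add: y_def sum_distrib_left sum_negf)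
      finally show ?thesis
        by (simp add: c'_def sum.distrib[symmetric] algebra_simps)
    qed
    have "c' e u = 0" for u by (simp add: c'_def)
    then have "(\<Sum>u\<in>U. c e' u * y u) = 0" if "e' \<in> insert e E" for e'
      using that x(2) by (auto simp: split)
    moreover have "\<exists>u\<in>U. y u \<noteq> 0" using x(1) z by (auto simp: y_def V_def)
    ultimately show ?thesis by blast
  qed
qed

text \<open>Equations are kept as functions of the labelling with hidden coefficients: linearity of
  a path label then follows by induction on the path, and equations can be counted as a set of
  functions.\<close>

definition linear_form :: "'u set \<Rightarrow> (('u \<Rightarrow> int) \<Rightarrow> int) \<Rightarrow> bool" where
  "linear_form U l \<longleftrightarrow> (\<exists>c. \<forall>x. l x = (\<Sum>u\<in>U. c u * x u))"

lemma linear_form_zero: "linear_form U (\<lambda>x. 0)"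
  unfolding linear_form_def by (intro exI[of _ "\<lambda>_. 0"]) simp

lemma linear_form_proj:
  assumes "finite U" "v \<in> U"
  shows "linear_form U (\<lambda>x. x v)"
  unfolding linear_form_def
proof (intro exI[of _ "\<lambda>u. if u = v then 1 else 0"] allI)
  fix x :: "'a \<Rightarrow> int"
  have "(\<Sum>u\<in>U. (if u = v then 1 else 0) * x u) = (\<Sum>u\<in>U. if u = v then x u else 0)"
    by (intro sum.cong) auto
  then show "x v = (\<Sum>u\<in>U. (if u = v then 1 else 0) * x u)"
    using assms by (simp add: sum.delta)
qed

lemma linear_form_add:
  assumes "linear_form U l" "linear_form U m"
  shows "linear_form U (\<lambda>x. l x + m x)"
proof -
  obtain c d where "l = (\<lambda>x. \<Sum>u\<in>U. c u * x u)" "m = (\<lambda>x. \<Sum>u\<in>U. d u * x u)"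
    using assms unfolding linear_form_def by blast
  then show ?thesis unfolding linear_form_def
    by (intro exI[of _ "\<lambda>u. c u + d u"]) (simp add: sum.distrib distrib_right)
qed

lemma linear_form_uminus:
  assumes "linear_form U l"
  shows "linear_form U (\<lambda>x. - l x)"
proof -
  obtain c where "l = (\<lambda>x. \<Sum>u\<in>U. c u * x u)"
    using assms unfolding linear_form_def by blast
  then show ?thesis unfolding linear_form_def
    by (intro exI[of _ "\<lambda>u. - c u"]) (simp add: sum_negf)
qed

text \<open>A nonzero solution is divided by its gcd. Primitivity is what later turns edge labels
  into a loop of label 1.\<close>

lemma exists_primitive_solution:
  assumes "finite U" "finite L" "card L < card U" "\<And>l. l \<in> L \<Longrightarrow> linear_form U l"
  obtains x where "\<And>u. u \<notin> U \<Longrightarrow> x u = 0" "\<And>l. l \<in> L \<Longrightarrow> l x = 0" "Gcd (x ` U) = 1"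
proof -
  obtain c where c: "\<And>l x. l \<in> L \<Longrightarrow> l x = (\<Sum>u\<in>U. c l u * x u)"
    using assms(4) unfolding linear_form_def by metis
  obtain x where x: "\<exists>u\<in>U. x u \<noteq> 0" "\<And>l. l \<in> L \<Longrightarrow> (\<Sum>u\<in>U. c l u * x u) = 0"
    using exists_nonzero_solution[OF assms(2,1,3), of c] by blast
  define g where "g = Gcd (x ` U)"
  have g: "g \<noteq> 0" using x(1) by (auto simp: g_def)
  define y where "y u = (if u \<in> U then x u div g else 0)" for u
  have gy: "g * y u = x u" if "u \<in> U" for u
    using that by (simp add: y_def g_def Gcd_dvd)
  have "l y = 0" if "l \<in> L" for l
  proof -
    have "g * l y = (\<Sum>u\<in>U. c l u * x u)"
      by (subst c[OF that]) (auto simp: sum_distrib_left mult.left_commute gy intro!: sum.cong)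
    then show ?thesis using x(2)[OF that] g by simp
  qed
  moreover have "Gcd (y ` U) = 1"
  proof -
    \<comment> \<open>The gcd of \<open>y\<close> times \<open>g\<close> divides every entry of
      \<open>x\<close>, hence \<open>g\<close> itself, so it is a unit.\<close>
    have "g * Gcd (y ` U) dvd a" if "a \<in> x ` U" for a
      using that gy by (metis (no_types, lifting) Gcd_dvd dvd_refl image_iff mult_dvd_mono)
    then have "g * Gcd (y ` U) dvd g * 1" by (simp add: g_def Gcd_greatest)
    then have "Gcd (y ` U) dvd 1" by (metis g dvd_times_left_cancel_iff)
    then show ?thesis by (metis is_unit_normalize normalize_Gcd)
  qed
  ultimately show ?thesis using that[of y] by (simp add: y_def)
qed

text \<open>Bezout, one element at a time. \<open>I\<close> will consist of the labels, or exponents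
  of labels, of closed paths.\<close>

lemma Gcd_in_subgroup:
  fixes I :: "int set"
  assumes "finite A" "A \<subseteq> I" "0 \<in> I" and diff: "\<And>a b. a \<in> I \<Longrightarrow> b \<in> I \<Longrightarrow> a - b \<in> I"
  shows "Gcd A \<in> I"
proof -
  have neg: "- a \<in> I" if "a \<in> I" for a using diff[OF assms(3) that] by simp
  have add: "a + b \<in> I" if "a \<in> I" "b \<in> I" for a b using diff[OF that(1) neg[OF that(2)]] by simp
  have nmult: "int m * a \<in> I" if "a \<in> I" for m a
    by (induction m) (use assms(3) that add in \<open>auto simp: algebra_simps\<close>)
  have mult: "m * a \<in> I" if "a \<in> I" for m a
    using nmult[OF that] neg by (cases m rule: int_cases2) fastforce+
  show ?thesis using assms(1,2)
  proof (induction A)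
    case (insert a A)
    obtain u v where "u * a + v * Gcd A = gcd a (Gcd A)" using bezout_int by blast
    then have "gcd a (Gcd A) \<in> I" using add mult insert by (metis insert_subset)
    then show ?case by simp
  qed (use assms(3) in simp)
qed

section \<open>Labelled actions of free groups\<close>

text \<open>The invariant \<open>f\<close> takes finitely many values and separates right cosets:
  every coset is that of a chosen representative of its value.\<close>

lemma (in group) finite_rcosetsI:
  assumes H: "subgroup H G" and fin: "finite (f ` carrier G)"
    and eq: "\<And>a b. a \<in> carrier G \<Longrightarrow> b \<in> carrier G \<Longrightarrow> f a = f b \<Longrightarrow> a \<otimes> inv b \<in> H"
  shows "finite (rcosets H)"
proof -
  define r where "r y = (SOME a. a \<in> carrier G \<and> f a = y)" for y
  have r: "r (f a) \<in> carrier G \<and> f (r (f a)) = f a" if "a \<in> carrier G" for a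
    unfolding r_def using someI[of "\<lambda>b. b \<in> carrier G \<and> f b = f a" a] that by auto
  have "H #> a = H #> r (f a)" if a: "a \<in> carrier G" for a
  proof -
    have "r (f a) \<otimes> inv a \<otimes> a \<in> H #> a"
      using eq[of "r (f a)" a] r[OF a] a by (auto simp: r_coset_def)
    then show ?thesis
      using repr_independence[OF _ a H] r[OF a] a by (simp add: m_assoc)
  qed
  then have "rcosets H \<subseteq> (\<lambda>y. H #> r y) ` f ` carrier G"
    by (auto simp: RCOSETS_def)
  then show ?thesis using fin finite_subset by blast
qed

text \<open>Applying the law to \<open>letter_inv l\<close> as well shows that letters act as
  permutations. Hence free reduction does not change where a word leads, and words act from the
  right through \<open>foldl\<close>.\<close>

locale state_action =
  fixes T :: "'s \<Rightarrow> 'a letter \<Rightarrow> 's"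
  assumes T_inv: "T (T s l) (letter_inv l) = s"
begin

lemma run_letter_mult: "foldl T s (letter_mult l w) = foldl T (T s l) w"
  by (cases w) (auto simp: T_inv)

lemma run_word_mult: "foldl T s (word_mult u v) = foldl T (foldl T s u) v"
  by (induction u arbitrary: s) (auto simp: word_mult_def run_letter_mult)

lemma run_mult: "foldl T s (u \<otimes>\<^bsub>free_group S\<^esub> v) = foldl T (foldl T s u) v"
  by (simp add: free_group_def run_word_mult)

lemma run_one: "foldl T s \<one>\<^bsub>free_group S\<^esub> = s"
  by (simp add: free_group_def)

lemma run_inv:
  assumes "w \<in> carrier (free_group S)"
  shows "foldl T (foldl T s w) (inv\<^bsub>free_group S\<^esub> w) = s"
    and "foldl T (foldl T s (inv\<^bsub>free_group S\<^esub> w)) w = s"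
  unfolding run_mult[symmetric, where S = S] group.r_inv[OF group_free_group assms]
    group.l_inv[OF group_free_group assms] by (rule run_one)+

end

text \<open>An inverse letter runs backwards along the positive edge that starts at its end point,
  so only positive edges carry a free choice of label.\<close>

definition edge_label ::
    "('q, 'm) monoid_scheme \<Rightarrow> ('s \<Rightarrow> 'a letter \<Rightarrow> 's) \<Rightarrow> ('s \<Rightarrow> 'a \<Rightarrow> 'q) \<Rightarrow> 's \<Rightarrow> 'a letter \<Rightarrow> 'q" where
  "edge_label Q T g s l = (if snd l then g s (fst l) else inv\<^bsub>Q\<^esub> g (T s l) (fst l))"

primrec path_label ::
    "('q, 'm) monoid_scheme \<Rightarrow> ('s \<Rightarrow> 'a letter \<Rightarrow> 's) \<Rightarrow> ('s \<Rightarrow> 'a \<Rightarrow> 'q) \<Rightarrow> 's \<Rightarrow> 'a letter list \<Rightarrow> 'q" where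
  "path_label Q T g s [] = \<one>\<^bsub>Q\<^esub>"
| "path_label Q T g s (l # w) = edge_label Q T g s l \<otimes>\<^bsub>Q\<^esub> path_label Q T g (T s l) w"

locale labelled_action = group Q + state_action T
  for Q :: "('q, 'm) monoid_scheme" (structure) and T :: "'s \<Rightarrow> 'a letter \<Rightarrow> 's" +
  fixes g :: "'s \<Rightarrow> 'a \<Rightarrow> 'q"
  assumes g_closed: "g s a \<in> carrier Q"
begin

abbreviation "L \<equiv> path_label Q T g"

lemma edge_closed [simp]: "edge_label Q T g s l \<in> carrier Q"
  by (simp add: edge_label_def g_closed)

lemma label_closed [simp]: "L s w \<in> carrier Q"
  by (induction w arbitrary: s) auto

lemma edge_inv: "edge_label Q T g (T s l) (letter_inv l) = inv (edge_label Q T g s l)"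
  using T_inv[of s l] by (cases "snd l") (simp_all add: edge_label_def g_closed T_inv letter_inv_def)

lemma label_letter_mult: "L s (letter_mult l w) = edge_label Q T g s l \<otimes> L (T s l) w"
proof (cases w)
  case (Cons m w')
  then show ?thesis by (auto simp: edge_inv T_inv m_assoc[symmetric])
qed auto

lemma label_word_mult: "L s (word_mult u v) = L s u \<otimes> L (foldl T s u) v"
  by (induction u arbitrary: s) (auto simp: word_mult_def label_letter_mult m_assoc)

lemma label_mult: "L s (u \<otimes>\<^bsub>free_group S\<^esub> v) = L s u \<otimes> L (foldl T s u) v"
  by (simp add: free_group_def label_word_mult)

lemma label_one: "L s \<one>\<^bsub>free_group S\<^esub> = \<one>"
  by (simp add: free_group_def)

lemma label_inv:
  assumes "w \<in> carrier (free_group S)"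
  shows "L (foldl T s w) (inv\<^bsub>free_group S\<^esub> w) = inv (L s w)"
    and "L s (inv\<^bsub>free_group S\<^esub> w) = inv (L (foldl T s (inv\<^bsub>free_group S\<^esub> w)) w)"
proof -
  have 1: "L (foldl T s w) (inv\<^bsub>free_group S\<^esub> w) = inv (L s w)" for s
  proof -
    have "L s w \<otimes> L (foldl T s w) (inv\<^bsub>free_group S\<^esub> w) = \<one>"
      unfolding label_mult[symmetric, where S = S] group.r_inv[OF group_free_group assms]
      by (rule label_one)
    then have "L (foldl T s w) (inv\<^bsub>free_group S\<^esub> w) \<otimes> L s w = \<one>"
      by (rule inv_comm) simp_all
    from inv_equality[OF this] show ?thesis by simp
  qed
  show "L (foldl T s w) (inv\<^bsub>free_group S\<^esub> w) = inv (L s w)" by (rule 1)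
  show "L s (inv\<^bsub>free_group S\<^esub> w) = inv (L (foldl T s (inv\<^bsub>free_group S\<^esub> w)) w)"
    using 1[of "foldl T s (inv\<^bsub>free_group S\<^esub> w)"] unfolding run_inv(2)[OF assms] .
qed

text \<open>Conjugation only moves the base point inside the invariant set \<open>A\<close>.
  Demanding triviality at all points of \<open>A\<close> makes the set normal, so with the relators
  it contains their normal closure.\<close>

lemma trivial_labels_normal:
  assumes "\<And>s l. s \<in> A \<Longrightarrow> T s l \<in> A"
  shows "{w \<in> carrier (free_group S). \<forall>s\<in>A. foldl T s w = s \<and> L s w = \<one>} \<lhd> free_group S"
    (is "?M \<lhd> ?F")
proof -
  interpret F: group ?F by (rule group_free_group)
  have A: "foldl T s w \<in> A" if "s \<in> A" for s w
    using that by (induction w arbitrary: s) (auto intro: assms)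
  have inv: "foldl T s (inv\<^bsub>?F\<^esub> w) = s \<and> L s (inv\<^bsub>?F\<^esub> w) = \<one>" if w: "w \<in> ?M" and s: "s \<in> A" for s w
  proof -
    have w': "w \<in> carrier ?F" using w by simp
    let ?s = "foldl T s (inv\<^bsub>?F\<^esub> w)"
    have "?s \<in> A" using A[OF s] .
    then have "foldl T ?s w = ?s" "L ?s w = \<one>" using w by auto
    then show ?thesis using run_inv(2)[OF w', of s] label_inv(2)[OF w', of s] by simp
  qed
  have "subgroup ?M ?F"
  proof (rule F.subgroupI)
    show "?M \<noteq> {}" using run_one label_one by (auto intro!: exI[of _ "\<one>\<^bsub>?F\<^esub>"])
    show "inv\<^bsub>?F\<^esub> w \<in> ?M" if "w \<in> ?M" for w using inv[OF that] that by simp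
    show "v \<otimes>\<^bsub>?F\<^esub> w \<in> ?M" if "v \<in> ?M" "w \<in> ?M" for v w
      using that by (simp add: run_mult label_mult)
  qed auto
  moreover have "x \<otimes>\<^bsub>?F\<^esub> h \<otimes>\<^bsub>?F\<^esub> inv\<^bsub>?F\<^esub> x \<in> ?M" if x: "x \<in> carrier ?F" and h: "h \<in> ?M" for x h
  proof -
    have "foldl T (foldl T s x) h = foldl T s x \<and> L (foldl T s x) h = \<one>" if "s \<in> A" for s
      using h A[OF that] by simp
    then show ?thesis using x h by (simp add: run_mult label_mult run_inv(1) label_inv(1))
  qed
  ultimately show ?thesis by (simp add: F.normal_inv_iff)
qed

end

text \<open>
  The states are only observed through \<open>key\<close>: this allows to work in an infinite covering graph
  whose quotient by a group of deck transformations is finite.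
\<close>

locale periodic_action = labelled_action Q T g
  for Q :: "('q, 'm) monoid_scheme" (structure) and T :: "'s \<Rightarrow> 'a letter \<Rightarrow> 's"
    and g :: "'s \<Rightarrow> 'a \<Rightarrow> 'q" +
  fixes key :: "'s \<Rightarrow> 'k" and S :: "'a set" and s0 :: 's
  assumes key_T: "key s = key s' \<Longrightarrow> key (T s l) = key (T s' l)"
    and key_g: "key s = key s' \<Longrightarrow> g s a = g s' a"
    and finite_key: "finite ((\<lambda>w. key (foldl T s0 w)) ` carrier (free_group S))"
begin

definition "stab = {w \<in> carrier (free_group S). key (foldl T s0 w) = key s0}"

lemma key_run: "key s = key s' \<Longrightarrow> key (foldl T s w) = key (foldl T s' w)"
proof (induction w arbitrary: s s')
  case (Cons l w)
  show ?case using Cons.IH[OF key_T[OF Cons.prems]] by simp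
qed simp

lemma key_label:
  assumes "key s = key s'"
  shows "L s w = L s' w"
  using assms
proof (induction w arbitrary: s s')
  case (Cons l w)
  have "edge_label Q T g s l = edge_label Q T g s' l"
    unfolding edge_label_def key_g[OF Cons.prems] key_g[OF key_T[OF Cons.prems]] by (rule refl)
  moreover have "L (T s l) w = L (T s' l) w"
    by (rule Cons.IH[OF key_T[OF Cons.prems]])
  ultimately show ?case by simp
qed simp

lemma key_run_inv:
  assumes "a \<in> carrier (free_group S)" "b \<in> carrier (free_group S)"
    and "key (foldl T s0 a) = key (foldl T s0 b)"
  shows "a \<otimes>\<^bsub>free_group S\<^esub> inv\<^bsub>free_group S\<^esub> b \<in> stab"
proof -
  interpret F: group "free_group S" by (rule group_free_group)
  have "key (foldl T (foldl T s0 a) (inv\<^bsub>free_group S\<^esub> b)) = key s0"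
    using key_run[OF assms(3), of "inv\<^bsub>free_group S\<^esub> b"] unfolding run_inv(1)[OF assms(2)] .
  then show ?thesis using assms(1,2) by (simp add: stab_def run_mult)
qed

lemma subgroup_stab: "subgroup stab (free_group S)"
proof -
  interpret F: group "free_group S" by (rule group_free_group)
  show ?thesis
  proof (rule F.subgroupI)
    have "\<one>\<^bsub>free_group S\<^esub> \<in> stab" by (simp add: stab_def run_one)
    then show "stab \<noteq> {}" by blast
    fix a b assume ab: "a \<in> stab" "b \<in> stab"
    then show "a \<otimes>\<^bsub>free_group S\<^esub> b \<in> stab"
      using key_run[of "foldl T s0 a" s0 b] by (auto simp: stab_def run_mult)
    show "inv\<^bsub>free_group S\<^esub> a \<in> stab"
      using key_run_inv[of "\<one>\<^bsub>free_group S\<^esub>" a] ab by (simp add: stab_def run_one)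
  qed (auto simp: stab_def)
qed

lemma finite_rcosets_stab: "finite (rcosets\<^bsub>free_group S\<^esub> stab)"
  by (rule group.finite_rcosetsI[OF group_free_group subgroup_stab finite_key]) (rule key_run_inv)

text \<open>A word of \<open>stab\<close> need not close up in the covering graph, it only returns
  to the same key. Labels depend on the key alone, so the label is still multiplicative.\<close>

lemma label_stab_mult:
  assumes "a \<in> stab"
  shows "L s0 (a \<otimes>\<^bsub>free_group S\<^esub> b) = L s0 a \<otimes> L s0 b"
proof -
  have "key (foldl T s0 a) = key s0" using assms by (simp add: stab_def)
  then have "L (foldl T s0 a) b = L s0 b" by (rule key_label)
  then show ?thesis by (simp add: label_mult)
qed

lemma label_hom_stab: "L s0 \<in> hom (free_group S\<lparr>carrier := stab\<rparr>) Q"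
  using label_stab_mult by (auto simp: hom_def)

end

lemma free_group_singleton_closed:
  assumes "subgroup H (free_group S)" "\<And>a. a \<in> S \<Longrightarrow> [(a, True)] \<in> H"
  shows "H = carrier (free_group S)"
proof
  interpret F: group "free_group S" by (rule group_free_group)
  interpret H: subgroup H "free_group S" by fact
  show "H \<subseteq> carrier (free_group S)" by (rule H.subset)
  have letter: "[l] \<in> H" if "fst l \<in> S" for l
  proof (cases "snd l")
    case True
    then show ?thesis using assms(2)[OF that] by (cases l) auto
  next
    case False
    then have l: "l = (fst l, False)" by (cases l) auto
    have "[(fst l, False)] \<otimes>\<^bsub>free_group S\<^esub> [(fst l, True)] = \<one>\<^bsub>free_group S\<^esub>"
      by (simp add: free_group_def word_mult_def letter_inv_def)
    moreover have "[(fst l, False)] \<in> carrier (free_group S)"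
      using that by (simp add: free_group_def reduced_Cons)
    ultimately have "inv\<^bsub>free_group S\<^esub> [(fst l, True)] = [(fst l, False)]"
      using assms(2)[OF that] by (intro F.inv_equality) auto
    then show ?thesis using H.m_inv_closed[OF assms(2)[OF that]] l by metis
  qed
  have "w \<in> H" if "w \<in> carrier (free_group S)" for w
    using that
  proof (induction w)
    case Nil
    then show ?case using H.one_closed by (simp add: free_group_def)
  next
    case (Cons l w)
    then have "[l] \<in> H" "w \<in> H" by (auto simp: free_group_def reduced_Cons intro: letter)
    then have "[l] \<otimes>\<^bsub>free_group S\<^esub> w \<in> H" by (rule H.m_closed)
    moreover have "[l] \<otimes>\<^bsub>free_group S\<^esub> w = l # w"
      using Cons.prems by (cases w) (auto simp: free_group_def word_mult_def reduced_Cons)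
    ultimately show ?case by simp
  qed
  then show "carrier (free_group S) \<subseteq> H" by blast
qed

section \<open>Largeness from labelled actions\<close>

lemma free_group_two_not_comm: "a \<in> S \<Longrightarrow> b \<in> S \<Longrightarrow> a \<noteq> b \<Longrightarrow> \<not> comm_group (free_group S)"
proof
  assume ab: "a \<in> S" "b \<in> S" "a \<noteq> b" and "comm_group (free_group S)"
  then interpret comm_group "free_group S" by simp
  have "[(a, True)] \<in> carrier (free_group S)" "[(b, True)] \<in> carrier (free_group S)"
    using ab by (auto simp: free_group_def reduced_Cons)
  from m_comm[OF this] have "word_mult [(a, True)] [(b, True)] = word_mult [(b, True)] [(a, True)]"
    by (simp add: free_group_def)
  then show False using ab by (simp add: word_mult_def letter_inv_def)
qed

text \<open>\<open>G\<close> is handled through a surjection from the free group rather than through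
  cosets and an explicit isomorphism.\<close>

locale presentation = group G for G (structure) +
  fixes n :: nat and R :: "nat letter list list" and \<pi>
  assumes relators: "set R \<subseteq> carrier (free_group_rank n)"
    and hom_pi: "\<pi> \<in> hom (free_group_rank n) G"
    and surj_pi: "\<pi> ` carrier (free_group_rank n) = carrier G"
    and kernel_pi: "kernel (free_group_rank n) G \<pi> = normal_closure (free_group_rank n) (set R)"
begin

sublocale pi: group_hom "free_group_rank n" G \<pi>
  using group_free_group hom_pi by (simp add: group_hom_def group_hom_axioms_def group_axioms)

lemma pi_surj:
  assumes "g \<in> carrier G"
  obtains w where "w \<in> carrier (free_group_rank n)" "\<pi> w = g"
proof -
  have "g \<in> \<pi> ` carrier (free_group_rank n)" using assms surj_pi by simp
  then show thesis using that by (elim imageE) simp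
qed

lemma finitely_generated: "finitely_generated G"
proof -
  let ?A = "(\<lambda>a. \<pi> [(a, True)]) ` {..<n}"
  have gen: "[(a, True)] \<in> carrier (free_group_rank n)" if "a < n" for a
    using that by (simp add: free_group_def reduced_Cons)
  then have A: "?A \<subseteq> carrier G" by auto
  interpret A: subgroup "generate G ?A" G by (rule generate_is_subgroup[OF A])
  have "subgroup {w \<in> carrier (free_group_rank n). \<pi> w \<in> generate G ?A} (free_group_rank n)"
    by (rule pi.G.subgroupI) (auto intro!: exI[of _ "\<one>\<^bsub>free_group_rank n\<^esub>"])
  moreover have "[(a, True)] \<in> {w \<in> carrier (free_group_rank n). \<pi> w \<in> generate G ?A}"
    if "a \<in> {..<n}" for a
    using that gen generate.incl[of "\<pi> [(a, True)]" ?A G] by auto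
  ultimately have "{w \<in> carrier (free_group_rank n). \<pi> w \<in> generate G ?A} = carrier (free_group_rank n)"
    by (rule free_group_singleton_closed)
  then have *: "\<pi> w \<in> generate G ?A" if "w \<in> carrier (free_group_rank n)" for w
    using that by blast
  have "g \<in> generate G ?A" if "g \<in> carrier G" for g
    using pi_surj[OF that] * by metis
  then have "carrier G \<subseteq> generate G ?A" by blast
  then have "generate G ?A = carrier G" using A.subset by blast
  then show ?thesis
    unfolding finitely_generated_def using A group_axioms by (intro conjI exI[of _ ?A]) auto
qed

text \<open>Since \<open>\<phi>\<close> kills the kernel of \<open>\<pi>\<close>, it descends to the
  image of \<open>H\<close> in \<open>G\<close>, which again has finite index.\<close>

lemma large_if_hom:
  assumes H: "subgroup H (free_group_rank n)" "finite (rcosets\<^bsub>free_group_rank n\<^esub> H)"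
    and ker: "kernel (free_group_rank n) G \<pi> \<subseteq> H"
    and phi: "\<phi> \<in> hom (free_group_rank n\<lparr>carrier := H\<rparr>) (free_group S)"
    and phi_surj: "\<phi> ` H = carrier (free_group (S :: nat set))" "\<not> comm_group (free_group S)"
    and phi_ker: "\<And>w. w \<in> kernel (free_group_rank n) G \<pi> \<Longrightarrow> \<phi> w = \<one>\<^bsub>free_group S\<^esub>"
  shows "large G"
proof -
  let ?F = "free_group_rank n" and ?Q = "free_group S"
  interpret Q: group ?Q by (rule group_free_group)
  interpret H: subgroup H ?F by (rule H(1))
  define K where "K = \<pi> ` H"
  have K: "subgroup K G" unfolding K_def by (rule pi.subgroup_img_is_subgroup[OF H(1)])
  have phi_mult: "\<phi> (a \<otimes>\<^bsub>?F\<^esub> b) = \<phi> a \<otimes>\<^bsub>?Q\<^esub> \<phi> b" if "a \<in> H" "b \<in> H" for a b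
    using phi that by (auto simp: hom_def)
  have phi_closed: "\<phi> a \<in> carrier ?Q" if "a \<in> H" for a
    using phi_surj(1) that by blast
  define \<sigma> where "\<sigma> = inv_into (carrier ?F) \<pi>"
  have sigma: "\<sigma> g \<in> carrier ?F \<and> \<pi> (\<sigma> g) = g" if "g \<in> carrier G" for g
    using that inv_into_into[of g \<pi> "carrier ?F"] f_inv_into_f[of g \<pi> "carrier ?F"]
    by (simp add: \<sigma>_def surj_pi)
  have "finite (rcosets K)"
  proof (rule finite_rcosetsI[OF K])
    \<comment> \<open>Cosets of \<open>K\<close> are separated by the coset of \<open>H\<close> that
      contains a chosen lift to the free group.\<close>
    show "finite ((\<lambda>g. H #>\<^bsub>?F\<^esub> \<sigma> g) ` carrier G)"
      by (rule finite_subset[OF _ H(2)]) (use sigma in \<open>auto simp: RCOSETS_def\<close>)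
    fix a b assume ab: "a \<in> carrier G" "b \<in> carrier G" "H #>\<^bsub>?F\<^esub> \<sigma> a = H #>\<^bsub>?F\<^esub> \<sigma> b"
    note s = sigma[OF ab(1)] sigma[OF ab(2)]
    have "\<sigma> a \<in> H #>\<^bsub>?F\<^esub> \<sigma> b"
      using ab(3) pi.G.rcos_self[OF _ H(1)] s by metis
    then obtain h where h: "h \<in> H" "\<sigma> a = h \<otimes>\<^bsub>?F\<^esub> \<sigma> b" by (auto simp: r_coset_def)
    then have "a = \<pi> h \<otimes> b" using s by (metis H.mem_carrier pi.hom_mult)
    then have "a \<otimes> inv b = \<pi> h" using ab(2) H.mem_carrier[OF h(1)] by (simp add: m_assoc)
    then show "a \<otimes> inv b \<in> K" using h(1) by (simp add: K_def)
  qed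
  \<comment> \<open>Two preimages in \<open>H\<close> differ by an element of the kernel, so the
    choice does not matter.\<close>
  define \<psi> where "\<psi> g = \<phi> (SOME h. h \<in> H \<and> \<pi> h = g)" for g
  have psi: "\<psi> (\<pi> h) = \<phi> h" if h: "h \<in> H" for h
  proof -
    define k where "k = (SOME k. k \<in> H \<and> \<pi> k = \<pi> h)"
    have k: "k \<in> H" "\<pi> k = \<pi> h"
      using someI[of "\<lambda>k. k \<in> H \<and> \<pi> k = \<pi> h" h] h unfolding k_def by auto
    have "k \<otimes>\<^bsub>?F\<^esub> inv\<^bsub>?F\<^esub> h \<in> kernel ?F G \<pi>"
      using k h by (simp add: kernel_def)
    then have "\<phi> (k \<otimes>\<^bsub>?F\<^esub> inv\<^bsub>?F\<^esub> h) = \<one>\<^bsub>?Q\<^esub>" and "k \<otimes>\<^bsub>?F\<^esub> inv\<^bsub>?F\<^esub> h \<in> H"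
      using phi_ker ker by auto
    then have "\<phi> (k \<otimes>\<^bsub>?F\<^esub> inv\<^bsub>?F\<^esub> h \<otimes>\<^bsub>?F\<^esub> h) = \<phi> h"
      using h phi_mult phi_closed by simp
    then have "\<phi> k = \<phi> h" using k h by (simp add: pi.G.m_assoc)
    then show ?thesis by (simp add: \<psi>_def k_def)
  qed
  have "\<psi> \<in> hom (G\<lparr>carrier := K\<rparr>) ?Q"
  proof (rule homI)
    fix x y assume "x \<in> carrier (G\<lparr>carrier := K\<rparr>)" "y \<in> carrier (G\<lparr>carrier := K\<rparr>)"
    then obtain h k where hk: "h \<in> H" "k \<in> H" "x = \<pi> h" "y = \<pi> k" by (auto simp: K_def)
    then have "x \<otimes> y = \<pi> (h \<otimes>\<^bsub>?F\<^esub> k)" by simp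
    then show "\<psi> (x \<otimes>\<^bsub>G\<lparr>carrier := K\<rparr>\<^esub> y) = \<psi> x \<otimes>\<^bsub>?Q\<^esub> \<psi> y"
      using hk psi[of h] psi[of k] psi[of "h \<otimes>\<^bsub>?F\<^esub> k"] phi_mult[of h k] by simp
  qed (auto simp: K_def psi phi_closed)
  moreover have "\<psi> ` K = carrier ?Q"
    unfolding phi_surj(1)[symmetric] K_def image_image using psi by auto
  ultimately have "\<psi> \<in> epi (G\<lparr>carrier := K\<rparr>) ?Q" by (simp add: epi_def)
  then show ?thesis
    unfolding large_def finite_index_subgroup_def
    using finitely_generated K \<open>finite (rcosets K)\<close> phi_surj(2) by blast
qed

lemma kernel_acts_trivially:
  assumes "labelled_action Q T g"
    and A: "\<And>s l. s \<in> A \<Longrightarrow> T s l \<in> A"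
    and rel: "\<And>r s. r \<in> set R \<Longrightarrow> s \<in> A \<Longrightarrow> foldl T s r = s \<and> path_label Q T g s r = \<one>\<^bsub>Q\<^esub>"
    and w: "w \<in> kernel (free_group_rank n) G \<pi>" and s: "s \<in> A"
  shows "foldl T s w = s" "path_label Q T g s w = \<one>\<^bsub>Q\<^esub>"
proof -
  let ?M = "{w \<in> carrier (free_group_rank n). \<forall>s\<in>A. foldl T s w = s \<and> path_label Q T g s w = \<one>\<^bsub>Q\<^esub>}"
  have "?M \<lhd> free_group_rank n"
    using labelled_action.trivial_labels_normal[OF assms(1) A] by blast
  moreover have "set R \<subseteq> ?M" using relators rel by blast
  ultimately have "normal_closure (free_group_rank n) (set R) \<subseteq> ?M"
    unfolding normal_closure_def by blast
  then have "w \<in> ?M" using w kernel_pi by blast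
  then show "foldl T s w = s" "path_label Q T g s w = \<one>\<^bsub>Q\<^esub>" using s by auto
qed

text \<open>The label at \<open>s0\<close> is a homomorphism on the finite index subgroup
  \<open>stab\<close>. It kills the kernel because the relators are trivial at all states of
  \<open>A\<close>, and it is onto because both free generators are labels of elements of
  \<open>stab\<close>.\<close>

lemma large_if_periodic_action:
  fixes T :: "'s \<Rightarrow> nat letter \<Rightarrow> 's"
  assumes "periodic_action (free_group {0, 1 :: nat}) T g key {..<n} s0"
    and A: "\<And>s l. s \<in> A \<Longrightarrow> T s l \<in> A" "s0 \<in> A"
    and rel: "\<And>r s. r \<in> set R \<Longrightarrow> s \<in> A \<Longrightarrow>
      foldl T s r = s \<and> path_label (free_group {0, 1}) T g s r = \<one>\<^bsub>free_group {0, 1}\<^esub>"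
    and gen: "\<And>a. a \<in> {0, 1} \<Longrightarrow> \<exists>w\<in>carrier (free_group_rank n). key (foldl T s0 w) = key s0 \<and>
      path_label (free_group {0, 1}) T g s0 w = [(a, True)]"
  shows "large G"
proof -
  let ?Q = "free_group {0, 1 :: nat}" and ?F = "free_group_rank n"
  interpret P: periodic_action ?Q T g key "{..<n}" s0 by (rule assms(1))
  have ker: "foldl T s0 w = s0" "P.L s0 w = \<one>\<^bsub>?Q\<^esub>" if "w \<in> kernel ?F G \<pi>" for w
    using kernel_acts_trivially[OF P.labelled_action_axioms, where A = A] A rel that by blast+
  interpret st: group_hom "?F\<lparr>carrier := P.stab\<rparr>" ?Q "P.L s0"
    by (intro group_hom.intro group_hom_axioms.intro pi.G.subgroup_imp_group P.subgroup_stab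
        P.label_hom_stab P.group_axioms)
  have "subgroup (P.L s0 ` P.stab) ?Q"
    using st.img_is_subgroup by simp
  then have surj: "P.L s0 ` P.stab = carrier ?Q"
  proof (rule free_group_singleton_closed)
    fix a :: nat assume "a \<in> {0, 1}"
    from gen[OF this] obtain w where "w \<in> P.stab" "P.L s0 w = [(a, True)]"
      unfolding P.stab_def by blast
    then show "[(a, True)] \<in> P.L s0 ` P.stab" by force
  qed
  show ?thesis
  proof (rule large_if_hom[OF P.subgroup_stab P.finite_rcosets_stab _ P.label_hom_stab surj])
    show "kernel ?F G \<pi> \<subseteq> P.stab"
      using ker(1) by (auto simp: P.stab_def kernel_def)
    show "\<not> comm_group ?Q" by (rule free_group_two_not_comm[of 0 _ 1]) auto
    show "P.L s0 w = \<one>\<^bsub>?Q\<^esub>" if "w \<in> kernel ?F G \<pi>" for w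
      by (rule ker(2)[OF that])
  qed
qed

end

section \<open>Covers and path labels\<close>

lemma linear_form_path_label:
  assumes g: "\<And>s a. s \<in> A \<Longrightarrow> a \<in> S \<Longrightarrow> linear_form U (\<lambda>x. g x s a)"
    and A: "\<And>s l. s \<in> A \<Longrightarrow> T s l \<in> A"
    and "s \<in> A" "fst ` set w \<subseteq> S"
  shows "linear_form U (\<lambda>x. path_label integer_group T (g x) s w)"
  using assms(3,4)
proof (induction w arbitrary: s)
  case Nil
  show ?case by (simp add: linear_form_zero)
next
  case (Cons l w)
  have "linear_form U (\<lambda>x. edge_label integer_group T (g x) s l)"
    using Cons.prems g[of s "fst l"] linear_form_uminus[OF g[of "T s l" "fst l"]] A[of s l]
    by (cases "snd l") (simp_all add: edge_label_def)
  from linear_form_add[OF this Cons.IH[OF A[OF Cons.prems(1)]]] show ?case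
    using Cons.prems(2) by simp
qed

primrec stays :: "'s set \<Rightarrow> ('s \<Rightarrow> 'a letter \<Rightarrow> 's) \<Rightarrow> 's \<Rightarrow> 'a letter list \<Rightarrow> bool" where
  "stays A T s [] \<longleftrightarrow> s \<in> A"
| "stays A T s (l # w) \<longleftrightarrow> s \<in> A \<and> stays A T (T s l) w"

lemma stays_start: "stays A T s w \<Longrightarrow> s \<in> A"
  by (cases w) auto

text \<open>Over a region where all labels are powers of one element, the label is governed by an
  integer label. This reduces relations in a free group to linear equations over the
  integers.\<close>

lemma (in labelled_action) label_eq_pow:
  assumes y: "y \<in> carrier Q"
    and eq: "\<And>s a. s \<in> A \<Longrightarrow> T s (a, True) \<in> A \<Longrightarrow> g s a = y [^] (g' s a :: int)"
    and "stays A T s w"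
  shows "L s w = y [^] path_label integer_group T g' s w"
  using assms(3)
proof (induction w arbitrary: s)
  case Nil
  show ?case by simp
next
  case (Cons l w)
  then have s: "s \<in> A" "T s l \<in> A" by (auto intro: stays_start)
  have "edge_label Q T g s l = y [^] edge_label integer_group T g' s l"
  proof (cases "snd l")
    case True
    then have "l = (fst l, True)" by (cases l) auto
    then show ?thesis using eq[OF s(1), of "fst l"] s by (metis edge_label_def True)
  next
    case False
    then have "letter_inv l = (fst l, True)" by (simp add: letter_inv_def)
    then have "T (T s l) (fst l, True) = s" using T_inv[of s l] by simp
    then have "g (T s l) (fst l) = y [^] g' (T s l) (fst l)" using eq[OF s(2)] s by simp
    then show ?thesis using False y by (simp add: edge_label_def int_pow_neg)
  qed
  moreover have "L (T s l) w = y [^] path_label integer_group T g' (T s l) w"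
    using Cons by simp
  ultimately show ?case using y by (simp add: int_pow_mult)
qed

text \<open>The label telescopes along the path.\<close>

lemma (in state_action) path_label_coboundary:
  "path_label integer_group T (\<lambda>s a. p (T s (a, True)) - p s) s w = p (foldl T s w) - p s"
proof (induction w arbitrary: s)
  case (Cons l w)
  have "edge_label integer_group T (\<lambda>s a. p (T s (a, True)) - p s) s l = p (T s l) - p s"
  proof (cases "snd l")
    case True
    then show ?thesis by (cases l) (simp add: edge_label_def)
  next
    case False
    then have "letter_inv l = (fst l, True)" by (simp add: letter_inv_def)
    then show ?thesis using T_inv[of s l] False by (simp add: edge_label_def)
  qed
  then show ?case using Cons[of "T s l"] by simp
qed simp

lemma (in state_action) labelled_action_int: "labelled_action integer_group T \<chi>"
  by (intro labelled_action.intro labelled_action_axioms.intro group_integer_group state_action_axioms) simp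

text \<open>The infinite cyclic cover given by the integer labelling \<open>\<chi>\<close>; the
  second component is the sheet.\<close>

definition cover :: "('s \<Rightarrow> 'a letter \<Rightarrow> 's) \<Rightarrow> ('s \<Rightarrow> 'a \<Rightarrow> int) \<Rightarrow> 's \<times> int \<Rightarrow> 'a letter \<Rightarrow> 's \<times> int" where
  "cover T \<chi> s l = (T (fst s) l, snd s + edge_label integer_group T \<chi> (fst s) l)"

lemma run_cover: "foldl (cover T \<chi>) s w = (foldl T (fst s) w, snd s + path_label integer_group T \<chi> (fst s) w)"
  by (induction w arbitrary: s) (auto simp: cover_def)

lemma (in state_action) state_action_cover: "state_action (cover T \<chi>)"
proof -
  interpret labelled_action integer_group T \<chi> by (rule labelled_action_int)
  show ?thesis by unfold_locales (simp add: cover_def T_inv edge_inv)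
qed

text \<open>Each letter shifts the sheet by at most \<open>B\<close>, so a path drifts by at most
  \<open>B\<close> times its length.\<close>

lemma stays_cover:
  assumes B: "\<And>s a. \<bar>\<chi> s a\<bar> \<le> B" and "\<bar>snd s - j\<bar> + B * int (length w) \<le> C"
  shows "stays {s. \<bar>snd s - j\<bar> \<le> C} (cover T \<chi>) s w"
  using assms(2)
proof (induction w arbitrary: s)
  case Nil
  then show ?case by simp
next
  case (Cons l w)
  have B0: "B \<ge> 0" using B[of undefined undefined] by linarith
  have "\<bar>edge_label integer_group T \<chi> (fst s) l\<bar> \<le> B"
    using B by (simp add: edge_label_def)
  then have "\<bar>snd (cover T \<chi> s l) - j\<bar> \<le> \<bar>snd s - j\<bar> + B" by (simp add: cover_def)
  moreover have "\<bar>snd s - j\<bar> + (B + B * int (length w)) \<le> C"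
    using Cons.prems by (simp add: algebra_simps)
  ultimately have "stays {s. \<bar>snd s - j\<bar> \<le> C} (cover T \<chi>) (cover T \<chi> s l) w"
    by (intro Cons.IH) linarith
  moreover have "B * int (length w) \<ge> 0" using B0 by simp
  then have "\<bar>snd s - j\<bar> \<le> C" using \<open>\<bar>snd s - j\<bar> + (B + B * int (length w)) \<le> C\<close> B0 by linarith
  ultimately show ?case by simp
qed

text \<open>Only the whole word is assumed to close up at \<open>s\<close>. The state before the
  last segment is then the one reached from \<open>s\<close> by \<open>v\<close>, so the two inverse
  segments are \<open>u\<close> from that state and \<open>v\<close> from \<open>s\<close>, read
  backwards.\<close>

lemma (in labelled_action) label_commutator:
  assumes "u \<in> carrier (free_group S)" "v \<in> carrier (free_group S)"
    and r: "r = u \<otimes>\<^bsub>free_group S\<^esub> v \<otimes>\<^bsub>free_group S\<^esub> inv\<^bsub>free_group S\<^esub> u \<otimes>\<^bsub>free_group S\<^esub> inv\<^bsub>free_group S\<^esub> v"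
    and fixed: "foldl T s r = s"
  shows "L s r = L s u \<otimes> L (foldl T s u) v \<otimes> inv (L (foldl T s v) u) \<otimes> inv (L s v)"
proof -
  let ?t = "foldl T (foldl T (foldl T s u) v) (inv\<^bsub>free_group S\<^esub> u)"
  have t: "foldl T ?t (inv\<^bsub>free_group S\<^esub> v) = s" using fixed by (simp add: r run_mult)
  then have t': "?t = foldl T s v" using run_inv(2)[OF assms(2), of ?t] by simp
  have "L (foldl T (foldl T s u) v) (inv\<^bsub>free_group S\<^esub> u) = inv (L (foldl T s v) u)"
    using label_inv(2)[OF assms(1), of "foldl T (foldl T s u) v"] unfolding t' .
  moreover have "L ?t (inv\<^bsub>free_group S\<^esub> v) = inv (L s v)"
    using label_inv(2)[OF assms(2), of ?t] unfolding t .
  ultimately show ?thesis by (simp add: r label_mult run_mult)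
qed

section \<open>A character vanishing on the commutator\<close>

text \<open>\<open>V\<close> is the vertex set of the Schreier graph of a finite index subgroup, and
  \<open>uv_fix\<close> says that \<open>u\<close> and \<open>v\<close> lie in this
  subgroup.\<close>

locale commutator_action = state_action T
  for T :: "'s \<Rightarrow> nat letter \<Rightarrow> 's" +
  fixes n :: nat and R :: "nat letter list list" and u v r0 :: "nat letter list"
    and V :: "'s set" and x0 :: 's
  assumes relators: "set R \<subseteq> carrier (free_group_rank n)"
    and deficiency_one: "Suc (length R) = n"
    and uv: "u \<in> carrier (free_group_rank n)" "v \<in> carrier (free_group_rank n)"
    and r0: "r0 = u \<otimes>\<^bsub>free_group_rank n\<^esub> v \<otimes>\<^bsub>free_group_rank n\<^esub>
        inv\<^bsub>free_group_rank n\<^esub> u \<otimes>\<^bsub>free_group_rank n\<^esub> inv\<^bsub>free_group_rank n\<^esub> v"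
      "r0 \<in> set R"
    and V: "finite V" "x0 \<in> V" "\<And>x l. x \<in> V \<Longrightarrow> T x l \<in> V"
    and relators_fix: "\<And>r x. r \<in> set R \<Longrightarrow> x \<in> V \<Longrightarrow> foldl T x r = x"
    and uv_fix: "foldl T x0 u = x0" "foldl T x0 v = x0"
    and transitive: "\<And>x. x \<in> V \<Longrightarrow> \<exists>w\<in>carrier (free_group_rank n). foldl T x0 w = x"
begin

abbreviation "intlabel \<equiv> path_label integer_group T"

lemma run_V: "x \<in> V \<Longrightarrow> foldl T x w \<in> V"
  by (induction w arbitrary: x) (auto intro: V)

lemma letters_bound: "w \<in> carrier (free_group_rank n) \<Longrightarrow> fst ` set w \<subseteq> {..<n}"
  by (simp add: free_group_def)

text \<open>Repetitions in the list of relators only lower the number of distinct equations.\<close>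

lemma card_relators: "card (set R - {r0}) + 2 \<le> n"
proof -
  have "card (set R) \<le> length R" by (rule card_length)
  moreover have "card (set R) > 0" using r0(2) by (auto simp: card_gt_0_iff)
  ultimately show ?thesis using deficiency_one r0(2) by simp
qed

lemma bij_run:
  assumes "w \<in> carrier (free_group_rank n)"
  shows "bij_betw (\<lambda>x. foldl T x w) V V"
  using run_inv[OF assms] run_V
  by (intro bij_betw_byWitness[where f' = "\<lambda>x. foldl T x (inv\<^bsub>free_group_rank n\<^esub> w)"]) auto

lemma intlabel_commutator:
  assumes "x \<in> V"
  shows "intlabel g x r0 = intlabel g x u + intlabel g (foldl T x u) v
    - intlabel g (foldl T x v) u - intlabel g x v"
proof -
  interpret I: labelled_action integer_group T g by (rule labelled_action_int)
  show ?thesis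
    using I.label_commutator[OF uv r0(1) relators_fix[OF r0(2) assms]] by simp
qed

lemma sum_commutator: "(\<Sum>x\<in>V. intlabel g x r0) = 0"
proof -
  have "(\<Sum>x\<in>V. intlabel g (foldl T x u) v) = (\<Sum>x\<in>V. intlabel g x v)"
    by (rule sum.reindex_bij_betw[OF bij_run[OF uv(1)]])
  moreover have "(\<Sum>x\<in>V. intlabel g (foldl T x v) u) = (\<Sum>x\<in>V. intlabel g x u)"
    by (rule sum.reindex_bij_betw[OF bij_run[OF uv(2)]])
  ultimately show ?thesis
    by (simp add: intlabel_commutator sum.distrib sum_subtractf cong: sum.cong)
qed

lemma linear_form_intlabel:
  assumes "s \<in> V" "w \<in> carrier (free_group_rank n)"
  shows "linear_form (V \<times> {..<n}) (\<lambda>x. intlabel (\<lambda>s a. x (s, a)) s w)"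
  by (rule linear_form_path_label[where A = V and S = "{..<n}"])
     (use assms V letters_bound in \<open>auto intro: linear_form_proj\<close>)

text \<open>
  The relations at \<open>r0\<close> count for \<open>card V - 2\<close> equations only: the one at \<open>x0\<close> is
  void, and the sum of all of them is zero.
\<close>

lemma exists_character:
  assumes "card V \<ge> 2"
  obtains \<chi> where "\<And>x a. x \<notin> V \<or> a \<ge> n \<Longrightarrow> \<chi> x a = 0"
    and "\<And>x r. x \<in> V \<Longrightarrow> r \<in> set R \<Longrightarrow> intlabel \<chi> x r = 0"
    and "intlabel \<chi> x0 u = 0" "intlabel \<chi> x0 v = 0"
    and "\<exists>w\<in>carrier (free_group_rank n). foldl T x0 w = x0 \<and> intlabel \<chi> x0 w = 1"
    and "\<And>x. x \<in> V \<Longrightarrow> \<exists>q\<in>carrier (free_group_rank n). foldl T x0 q = x \<and> intlabel \<chi> x0 q = 0"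
proof -
  let ?F = "free_group_rank n"
  interpret F: group ?F by (rule group_free_group)
  define eq where "eq s w = (\<lambda>x :: 's \<times> nat \<Rightarrow> int. intlabel (\<lambda>s a. x (s, a)) s w)" for s w
  obtain x1 where x1: "x1 \<in> V" "x1 \<noteq> x0"
    using assms V by (metis One_nat_def Suc_1 card_le_Suc0_iff_eq not_less_eq_eq)
  have "\<forall>x\<in>V. \<exists>q. q \<in> carrier ?F \<and> foldl T x0 q = x" using transitive by blast
  then obtain q where q: "\<And>x. x \<in> V \<Longrightarrow> q x \<in> carrier ?F \<and> foldl T x0 (q x) = x"
    by metis
  let ?R = "set R - {r0}"
  \<comment> \<open>Besides the relators and the loops \<open>u\<close> and \<open>v\<close>, the
    paths \<open>q x\<close> are normalised to label zero. With \<open>d\<close> states these are at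
    most \<open>(card ?R + 2) * d - 1\<close> equations, fewer than the \<open>n * d\<close>
    unknowns.\<close>
  define E where "E = (\<lambda>(r, x). eq x r) ` (?R \<times> V) \<union> (\<lambda>x. eq x r0) ` (V - {x0, x1})
    \<union> {eq x0 u, eq x0 v} \<union> (\<lambda>x. eq x0 (q x)) ` (V - {x0})"
  let ?d = "card V"
  have fin: "finite E" using V by (simp add: E_def)
  have "card E \<le> card ((\<lambda>(r, x). eq x r) ` (?R \<times> V)) + card ((\<lambda>x. eq x r0) ` (V - {x0, x1}))
      + card {eq x0 u, eq x0 v} + card ((\<lambda>x. eq x0 (q x)) ` (V - {x0}))"
    unfolding E_def by (intro order.trans[OF card_Un_le] add_mono order.refl)
  also have "\<dots> \<le> card (?R \<times> V) + card (V - {x0, x1}) + 2 + card (V - {x0})"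
    using V by (intro add_mono card_image_le) (auto simp: card_insert_if)
  also have "\<dots> = card ?R * ?d + (?d - 2) + 2 + (?d - 1)"
    using V x1 by (simp add: card_cartesian_product card_Diff_subset)
  also have "\<dots> < card ?R * ?d + 2 * ?d" using assms by linarith
  also have "\<dots> = (card ?R + 2) * ?d" by (simp add: algebra_simps)
  also have "\<dots> \<le> n * ?d" using card_relators by (intro mult_right_mono) auto
  also have "\<dots> = card (V \<times> {..<n})" by (simp add: card_cartesian_product)
  finally have card: "card E < card (V \<times> {..<n})" .
  have carr: "r \<in> carrier ?F" if "r \<in> set R" for r using relators that by blast
  have lin: "linear_form (V \<times> {..<n}) l" if "l \<in> E" for l
    using that q V uv carr r0(2) unfolding E_def eq_def
    by (auto intro!: linear_form_intlabel)
  obtain x where x: "\<And>e. e \<notin> V \<times> {..<n} \<Longrightarrow> x e = 0" "\<And>l. l \<in> E \<Longrightarrow> l x = 0"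
      "Gcd (x ` (V \<times> {..<n})) = 1"
    using exists_primitive_solution[OF _ fin card lin] V by auto
  define \<chi> where "\<chi> s a = x (s, a)" for s a
  interpret I: labelled_action integer_group T \<chi> by (rule labelled_action_int)
  have eq0: "intlabel \<chi> s w = 0" if "eq s w \<in> E" for s w
    using x(2)[OF that] by (simp add: eq_def \<chi>_def[abs_def])
  have uv0: "intlabel \<chi> x0 u = 0" "intlabel \<chi> x0 v = 0" by (rule eq0, simp add: E_def)+
  have r_x0: "intlabel \<chi> x0 r0 = 0" using V by (simp add: intlabel_commutator uv_fix)
  have r_x: "intlabel \<chi> s r0 = 0" if "s \<in> V - {x0, x1}" for s
    using that by (intro eq0) (simp add: E_def)
  \<comment> \<open>The equation at \<open>x1\<close>, omitted from \<open>E\<close>, follows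
    because the sum over all lifts vanishes.\<close>
  have "0 = (\<Sum>s\<in>V. intlabel \<chi> s r0)" by (rule sum_commutator[symmetric])
  also have "\<dots> = (\<Sum>s\<in>{x0, x1}. intlabel \<chi> s r0)"
    using V x1 r_x by (intro sum.mono_neutral_right) auto
  also have "\<dots> = intlabel \<chi> x1 r0" using x1 r_x0 by simp
  finally have r_x1: "intlabel \<chi> x1 r0 = 0" by simp
  have rel: "intlabel \<chi> s r = 0" if "s \<in> V" "r \<in> set R" for s r
  proof (cases "r = r0")
    case True
    then show ?thesis using that r_x0 r_x1 r_x by (cases "s \<in> {x0, x1}") auto
  next
    case False
    then show ?thesis using that by (intro eq0) (force simp: E_def)
  qed
  \<comment> \<open>\<open>q x0\<close> is a loop whose label \<open>E\<close> does not control, so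
    the empty path replaces it.\<close>
  define p where "p s = (if s = x0 then \<one>\<^bsub>?F\<^esub> else q s)" for s
  have p: "p s \<in> carrier ?F" "foldl T x0 (p s) = s" "intlabel \<chi> x0 (p s) = 0" if "s \<in> V" for s
    using that q[OF that] by (auto simp: p_def run_one I.label_one intro: eq0 simp: E_def)
  define I where "I = {e. \<exists>w\<in>carrier ?F. foldl T x0 w = x0 \<and> intlabel \<chi> x0 w = e}"
  have "Gcd (x ` (V \<times> {..<n})) \<in> I"
  proof (rule Gcd_in_subgroup)
    show "0 \<in> I" unfolding I_def
      using run_one I.label_one by (intro CollectI bexI[of _ "\<one>\<^bsub>?F\<^esub>"]) auto
    fix a b assume "a \<in> I" "b \<in> I"
    then obtain w w' where w: "w \<in> carrier ?F" "foldl T x0 w = x0" "intlabel \<chi> x0 w = a"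
      and w': "w' \<in> carrier ?F" "foldl T x0 w' = x0" "intlabel \<chi> x0 w' = b"
      by (auto simp: I_def)
    have "foldl T x0 (w \<otimes>\<^bsub>?F\<^esub> inv\<^bsub>?F\<^esub> w') = x0"
      using run_inv(1)[OF w'(1), of x0] w w' by (simp add: run_mult)
    moreover have "intlabel \<chi> x0 (w \<otimes>\<^bsub>?F\<^esub> inv\<^bsub>?F\<^esub> w') = a - b"
      using I.label_inv(1)[OF w'(1), of x0] w w' by (simp add: I.label_mult)
    ultimately show "a - b \<in> I" unfolding I_def using w w' by blast
  next
    show "x ` (V \<times> {..<n}) \<subseteq> I"
    proof (rule image_subsetI)
      fix e assume "e \<in> V \<times> {..<n}"
      then obtain s a where e: "e = (s, a)" and s: "s \<in> V" and "a \<in> {..<n}" by auto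
      let ?t = "T s (a, True)"
      have a: "[(a, True)] \<in> carrier ?F" using \<open>a \<in> {..<n}\<close> by (simp add: free_group_def reduced_Cons)
      have t: "?t \<in> V" using V s by blast
      \<comment> \<open>An edge closed up by paths of label zero is a loop at \<open>x0\<close> with
        the label of that edge.\<close>
      let ?w = "p s \<otimes>\<^bsub>?F\<^esub> [(a, True)] \<otimes>\<^bsub>?F\<^esub> inv\<^bsub>?F\<^esub> p ?t"
      have run: "foldl T ?t (inv\<^bsub>?F\<^esub> p ?t) = x0" "intlabel \<chi> ?t (inv\<^bsub>?F\<^esub> p ?t) = 0"
        using run_inv(1)[OF p(1)[OF t], of x0] I.label_inv(1)[OF p(1)[OF t], of x0] p[OF t] by simp_all
      have "foldl T x0 ?w = x0" using p[OF s] run by (simp add: run_mult)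
      moreover have "intlabel \<chi> x0 ?w = x (s, a)"
        using p[OF s] run by (simp add: run_mult I.label_mult edge_label_def \<chi>_def)
      moreover have "?w \<in> carrier ?F" using p[OF s] p[OF t] a by simp
      ultimately show "x e \<in> I" unfolding I_def e by blast
    qed
  qed (use V in auto)
  then have "\<exists>w\<in>carrier ?F. foldl T x0 w = x0 \<and> intlabel \<chi> x0 w = 1"
    unfolding x(3) I_def by blast
  moreover have "\<chi> s a = 0" if "s \<notin> V \<or> a \<ge> n" for s a
    using that x(1) by (auto simp: \<chi>_def)
  moreover have "\<exists>w\<in>carrier ?F. foldl T x0 w = s \<and> intlabel \<chi> x0 w = 0" if "s \<in> V" for s
    using p[OF that] by blast
  ultimately show thesis using that[of \<chi>] uv0 rel by blast
qed

end

section \<open>Free quotients of cyclic covers\<close>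

text \<open>In the cyclic cover, \<open>w\<close> climbs one sheet above \<open>x0\<close>, and
  \<open>q x\<close> ends over \<open>x\<close> in the sheet where it started.\<close>

locale commutator_character = commutator_action +
  fixes \<chi> :: "'a \<Rightarrow> nat \<Rightarrow> int" and w :: "nat letter list" and q :: "'a \<Rightarrow> nat letter list"
  assumes chi_support: "\<And>x a. x \<notin> V \<or> a \<ge> n \<Longrightarrow> \<chi> x a = 0"
    and chi_relator: "\<And>x r. x \<in> V \<Longrightarrow> r \<in> set R \<Longrightarrow> intlabel \<chi> x r = 0"
    and chi_uv: "intlabel \<chi> x0 u = 0" "intlabel \<chi> x0 v = 0"
    and w: "w \<in> carrier (free_group_rank n)" "foldl T x0 w = x0" "intlabel \<chi> x0 w = 1"
    and q: "\<And>x. x \<in> V \<Longrightarrow> q x \<in> carrier (free_group_rank n)"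
      "\<And>x. x \<in> V \<Longrightarrow> foldl T x0 (q x) = x" "\<And>x. x \<in> V \<Longrightarrow> intlabel \<chi> x0 (q x) = 0"
begin

declare One_nat_def [simp del]

abbreviation "F \<equiv> free_group_rank n"
abbreviation "Q \<equiv> free_group {0, 1 :: nat}"
abbreviation "t \<equiv> [(0 :: nat, True)]"
abbreviation "y \<equiv> [(1 :: nat, True)]"

abbreviation "T' \<equiv> cover T \<chi>"

definition step :: int where "step = (\<Sum>(x, a)\<in>V \<times> {..<n}. \<bar>\<chi> x a\<bar>)"
text \<open>Bounds the drift between sheets along each relator, along \<open>w\<close>, along each
  \<open>q x\<close> and, through the last summand, along a single edge.\<close>

definition radius :: int where
  "radius = step * (int (\<Sum>r\<in>set R. length r) + int (length w) + int (\<Sum>x\<in>V. length (q x))) + step"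
text \<open>A path that starts within \<open>radius\<close> of a cut and drifts by
  \<open>radius\<close> stays off the zone. The extra 1 is used up in \<open>t_loop\<close>, where
  the climb through the cut starts in sheet \<open>period - radius - 1\<close>.\<close>

definition margin :: int where "margin = 2 * radius + 1"
text \<open>One more than the number of edges discarded near the cut, so that this loss is
  outweighed by the \<open>period\<close> void lifts of \<open>r0\<close>.\<close>

definition period :: int where "period = 2 * margin * int n * int (card V) + 1"

abbreviation "zone \<equiv> {margin..<period - margin}"
abbreviation "key \<equiv> \<lambda>s :: 'a \<times> int. (fst s, snd s mod period)"
text \<open>Lies \<open>radius\<close> sheets above the cut, so that a path drifting by at most
  \<open>radius\<close> from here does not cross it.\<close>

abbreviation "base \<equiv> (x0, radius)"

lemma abs_chi_le: "\<bar>\<chi> x a\<bar> \<le> step"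
proof (cases "x \<in> V \<and> a < n")
  case True
  then show ?thesis
    using member_le_sum[of "(x, a)" "V \<times> {..<n}" "\<lambda>(x, a). \<bar>\<chi> x a\<bar>"] V(1)
    by (auto simp: step_def)
next
  case False
  then have "x \<notin> V \<or> a \<ge> n" by auto
  then have "\<chi> x a = 0" by (rule chi_support)
  moreover have "step \<ge> 0" unfolding step_def by (intro sum_nonneg) auto
  ultimately show ?thesis by simp
qed

lemma step_nonneg: "0 \<le> step"
  using abs_chi_le[of undefined undefined] by linarith

lemma radius_bounds:
  shows "r \<in> set R \<Longrightarrow> step * int (length r) \<le> radius"
    and "step * int (length w) \<le> radius"
    and "x \<in> V \<Longrightarrow> step * int (length (q x)) \<le> radius"
    and "step \<le> radius"
proof -
  let ?l = "int (\<Sum>r\<in>set R. length r) + int (length w) + int (\<Sum>x\<in>V. length (q x))"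
  have *: "step * m \<le> radius" if "m \<le> ?l" for m
  proof -
    have "step * m \<le> step * ?l" using that step_nonneg by (rule mult_left_mono)
    then show ?thesis using step_nonneg unfolding radius_def by linarith
  qed
  show "step * int (length r) \<le> radius" if "r \<in> set R"
  proof -
    have "length r \<le> (\<Sum>r\<in>set R. length r)" using that by (intro member_le_sum[of r _ length]) auto
    then show ?thesis by (intro *) linarith
  qed
  show "step * int (length w) \<le> radius" by (intro *) linarith
  show "step * int (length (q x)) \<le> radius" if "x \<in> V"
  proof -
    have "length (q x) \<le> (\<Sum>x\<in>V. length (q x))" using that V(1) by (intro member_le_sum[of x _ "\<lambda>x. length (q x)"]) auto
    then show ?thesis by (intro *) linarith
  qed
  have "step * 0 \<le> step * ?l" using step_nonneg by (intro mult_left_mono) linarith+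
  then show "step \<le> radius" unfolding radius_def by simp
qed

lemma n_pos: "n \<ge> 1"
  using deficiency_one by simp

lemma card_V_pos: "card V \<ge> 1"
  using V by (metis One_nat_def Suc_leI card_gt_0_iff empty_iff)

lemma radius_nonneg: "0 \<le> radius"
  using radius_bounds(4) step_nonneg by linarith

lemma period_gt: "2 * margin < period"
proof -
  have "1 \<le> n * card V" using mult_le_mono[OF n_pos card_V_pos] by simp
  then have "1 \<le> int n * int (card V)" by (metis of_nat_1 of_nat_le_iff of_nat_mult)
  then have "2 * margin * 1 \<le> 2 * margin * (int n * int (card V))"
    using radius_nonneg by (intro mult_left_mono) (simp_all add: margin_def)
  then show ?thesis by (simp add: period_def mult.assoc)
qed

lemma not_zoneI: "j mod period \<notin> zone"
  if "- margin \<le> j \<and> j < margin \<or> period - margin \<le> j \<and> j < period + margin"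
proof -
  consider "j < 0" | "0 \<le> j" "j < period" | "j \<ge> period" by linarith
  then show ?thesis
  proof cases
    case 1
    then have "j mod period = j + period"
      using that period_gt mod_pos_pos_trivial[of "j + period" period] by auto
    then show ?thesis using that 1 period_gt by auto
  next
    case 2
    then show ?thesis using that period_gt by auto
  next
    case 3
    then have "j mod period = j - period"
      using that period_gt mod_pos_pos_trivial[of "j - period" period]
        minus_mod_self2[of j period] by auto
    then show ?thesis using that 3 period_gt by auto
  qed
qed

text \<open>
  The labels \<open>y\<close> record the unknown \<open>f\<close> in the zone away from the multiples of \<open>period\<close>, and \<open>t\<close> records
  the crossings of these multiples. No path of length bounded by \<open>radius\<close> sees both of them.
\<close>

definition ylabel :: "(('a \<times> nat) \<times> int \<Rightarrow> int) \<Rightarrow> 'a \<times> int \<Rightarrow> nat \<Rightarrow> int" where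
  "ylabel f s a = (if snd s mod period \<in> zone then f ((fst s, a), snd s mod period) else 0)"

definition freelabel :: "(('a \<times> nat) \<times> int \<Rightarrow> int) \<Rightarrow> 'a \<times> int \<Rightarrow> nat \<Rightarrow> nat letter list" where
  "freelabel f s a = y [^]\<^bsub>Q\<^esub> ylabel f s a \<otimes>\<^bsub>Q\<^esub>
     t [^]\<^bsub>Q\<^esub> (snd (T' s (a, True)) div period - snd s div period)"

sublocale Q: group Q by (rule group_free_group)

lemma gens_closed [simp]: "t \<in> carrier Q" "y \<in> carrier Q"
  by (auto simp: free_group_def reduced_Cons)

sublocale cov: state_action T' by (rule state_action_cover)

lemma key_T': "key s = key s' \<Longrightarrow> key (T' s l) = key (T' s' l)"
  by (auto simp: cover_def intro: mod_add_cong)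

text \<open>States with equal keys differ by a multiple of \<open>period\<close> in the sheet, which
  shifts both quotients equally. Hence the crossing numbers descend to keys, although the quotients
  themselves do not.\<close>

lemma div_change:
  assumes "s = (x, j)" "s' = (x', j')" "key s = key s'"
  shows "snd (T' s l) div period - snd s div period = snd (T' s' l) div period - snd s' div period"
proof -
  have x: "x' = x" and "j mod period = j' mod period" using assms by auto
  then obtain m where m: "j' = j + period * m"
    by (metis mod_eq_dvd_iff dvd_def add.commute diff_add_cancel)
  have "period \<noteq> 0" using period_gt radius_nonneg by (simp add: margin_def)
  then have "(e + period * m) div period = e div period + m" for e
    by simp
  from this[of j] this[of "j + edge_label integer_group T \<chi> x l"] show ?thesis
    unfolding assms(1,2) cover_def fst_conv snd_conv x m by (simp add: algebra_simps)
qed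

lemma finite_keys: "finite ((\<lambda>h. key (foldl T' base h)) ` carrier F)"
proof (rule finite_subset)
  show "(\<lambda>h. key (foldl T' base h)) ` carrier F \<subseteq> V \<times> {0..<period}"
    using run_V V period_gt radius_nonneg by (auto simp: run_cover margin_def)
qed (use V in simp)

lemma periodic_ylabel: "periodic_action integer_group T' (ylabel f) key {..<n} base"
  by (intro periodic_action.intro periodic_action_axioms.intro cov.labelled_action_int finite_keys key_T')
     (simp_all add: ylabel_def)

lemma periodic_freelabel: "periodic_action Q T' (freelabel f) key {..<n} base"
proof (intro periodic_action.intro periodic_action_axioms.intro finite_keys key_T'
    labelled_action.intro labelled_action_axioms.intro group_free_group cov.state_action_axioms)
  fix s s' a assume s: "key s = key s'"
  then have "ylabel f s a = ylabel f s' a" by (simp add: ylabel_def)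
  then show "freelabel f s a = freelabel f s' a"
    using div_change[OF surjective_pairing surjective_pairing s] by (simp add: freelabel_def)
qed (simp_all add: freelabel_def)

end

text \<open>The first two conditions are linear in \<open>f\<close>. With base paths normalised to
  zero, an edge closed up by them keeps its own label, and primitivity then produces
  \<open>y\<close>.\<close>

locale free_cover = commutator_character +
  fixes f :: "('a \<times> nat) \<times> int \<Rightarrow> int"
  assumes f_relator: "\<And>x i r. x \<in> V \<Longrightarrow> 0 \<le> i \<Longrightarrow> i < period \<Longrightarrow> r \<in> set R \<Longrightarrow>
      path_label integer_group T' (ylabel f) (x, i) r = 0"
    and f_base_paths: "\<And>x i. x \<in> V \<Longrightarrow> radius \<le> i \<Longrightarrow> i < period - radius \<Longrightarrow>
      path_label integer_group T' (ylabel f) base (w [^]\<^bsub>F\<^esub> nat (i - radius) \<otimes>\<^bsub>F\<^esub> q x) = 0"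
    and f_primitive: "Gcd (f ` ((V \<times> {..<n}) \<times> zone)) = 1"
begin

sublocale fl: periodic_action Q T' "freelabel f" key "{..<n}" base
  by (rule periodic_freelabel)

sublocale yl: periodic_action integer_group T' "ylabel f" key "{..<n}" base
  by (rule periodic_ylabel)

sublocale F: group F by (rule group_free_group)

text \<open>The path never leaves the sheets from 0 to \<open>period - 1\<close>, hence records no
  power of \<open>t\<close>.\<close>

lemma label_in_sheet:
  assumes "radius \<le> j" "j < period - radius" "step * int (length h) \<le> radius"
  shows "fl.L (x, j) h = y [^]\<^bsub>Q\<^esub> yl.L (x, j) h"
proof (rule fl.label_eq_pow)
  let ?A = "{s :: 'a \<times> int. \<bar>snd s - j\<bar> \<le> radius}"
  show "stays ?A T' (x, j) h"
    by (rule stays_cover[where B = step]) (use abs_chi_le assms(3) in auto)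
  fix s :: "'a \<times> int" and a assume "s \<in> ?A" "T' s (a, True) \<in> ?A"
  then have "snd s div period = 0" "snd (T' s (a, True)) div period = 0"
    using assms by (auto intro!: div_pos_pos_trivial)
  then show "freelabel f s a = y [^]\<^bsub>Q\<^esub> ylabel f s a"
    by (simp add: freelabel_def)
qed (rule gens_closed)

text \<open>The path avoids the zone, hence records no power of \<open>y\<close>, and the exponents
  of \<open>t\<close> telescope.\<close>

lemma label_near_cut:
  assumes "\<And>i. \<bar>i - j\<bar> \<le> radius \<Longrightarrow> i mod period \<notin> zone" "step * int (length h) \<le> radius"
  shows "fl.L (x, j) h = t [^]\<^bsub>Q\<^esub> (snd (foldl T' (x, j) h) div period - j div period)"
proof -
  let ?A = "{s :: 'a \<times> int. \<bar>snd s - j\<bar> \<le> radius}"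
  let ?p = "\<lambda>s :: 'a \<times> int. snd s div period"
  have "fl.L (x, j) h = t [^]\<^bsub>Q\<^esub> path_label integer_group T' (\<lambda>s a. ?p (T' s (a, True)) - ?p s) (x, j) h"
  proof (rule fl.label_eq_pow)
    show "stays ?A T' (x, j) h"
      by (rule stays_cover[where B = step]) (use abs_chi_le assms(2) in auto)
    fix s :: "'a \<times> int" and a assume "s \<in> ?A"
    then have "ylabel f s a = 0" using assms(1)[of "snd s"] by (auto simp: ylabel_def)
    then show "freelabel f s a = t [^]\<^bsub>Q\<^esub> (?p (T' s (a, True)) - ?p s)"
      by (simp add: freelabel_def)
  qed (rule gens_closed)
  then show ?thesis using cov.path_label_coboundary[of ?p "(x, j)" h] by simp
qed

lemma radius_period: "4 * radius + 2 < period"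
  using period_gt by (simp add: margin_def)

text \<open>Up to the period, a lift starts either far from the cuts, where its label is a power of
  \<open>y\<close> with exponent zero by \<open>f_relator\<close>, or near a cut, where the exponent
  of \<open>t\<close> along a closed path is zero.\<close>

lemma relator_label:
  assumes "s \<in> V \<times> UNIV" "r \<in> set R"
  shows "foldl T' s r = s" "fl.L s r = \<one>\<^bsub>Q\<^esub>"
proof -
  obtain x j where s: "s = (x, j)" "x \<in> V" using assms by auto
  have run: "foldl T' (x, i) r = (x, i)" for i
    using s relators_fix[OF assms(2)] chi_relator[OF _ assms(2)] by (simp add: run_cover)
  show "foldl T' s r = s" unfolding s(1) by (rule run)
  define i where "i = j mod period"
  have i: "0 \<le> i" "i < period" using radius_period radius_nonneg by (simp_all add: i_def)
  have "fl.L s r = fl.L (x, i) r" unfolding s by (rule fl.key_label) (simp add: i_def)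
  also have "\<dots> = \<one>\<^bsub>Q\<^esub>"
  proof (cases "radius \<le> i \<and> i < period - radius")
    case True
    then have "fl.L (x, i) r = y [^]\<^bsub>Q\<^esub> yl.L (x, i) r"
      by (intro label_in_sheet radius_bounds assms(2)) auto
    then show ?thesis using f_relator[OF s(2) i assms(2)] by simp
  next
    case False
    have "fl.L (x, i) r = t [^]\<^bsub>Q\<^esub> (snd (foldl T' (x, i) r) div period - i div period)"
    proof (intro label_near_cut radius_bounds assms(2))
      fix i' assume "\<bar>i' - i\<bar> \<le> radius"
      then show "i' mod period \<notin> zone"
        using False i radius_nonneg by (intro not_zoneI) (auto simp: margin_def)
    qed
    then show ?thesis unfolding run by simp
  qed
  finally show "fl.L s r = \<one>\<^bsub>Q\<^esub>" .
qed

lemma run_w: "foldl T' (x0, j) w = (x0, j + 1)"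
  using w by (simp add: run_cover)

lemma w_power_in_sheet:
  assumes "radius + int m < period - radius"
  shows "foldl T' base (w [^]\<^bsub>F\<^esub> m) = (x0, radius + int m) \<and>
    fl.L base (w [^]\<^bsub>F\<^esub> m) = y [^]\<^bsub>Q\<^esub> yl.L base (w [^]\<^bsub>F\<^esub> m)"
  using assms
proof (induction m)
  case 0
  then show ?case by (simp add: cov.run_one fl.label_one yl.label_one)
next
  case (Suc m)
  have "fl.L (x0, radius + int m) w = y [^]\<^bsub>Q\<^esub> yl.L (x0, radius + int m) w"
    using Suc.prems by (intro label_in_sheet radius_bounds(2)) auto
  then show ?case
    using Suc run_w by (simp add: cov.run_mult fl.label_mult yl.label_mult Q.int_pow_mult[symmetric] add_ac)
qed

definition base_path :: "'a \<Rightarrow> int \<Rightarrow> nat letter list" where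
  "base_path x i = w [^]\<^bsub>F\<^esub> nat (i - radius) \<otimes>\<^bsub>F\<^esub> q x"

lemma base_path:
  assumes "x \<in> V" "radius \<le> i" "i < period - radius"
  shows "base_path x i \<in> carrier F" "foldl T' base (base_path x i) = (x, i)"
    and "fl.L base (base_path x i) = \<one>\<^bsub>Q\<^esub>"
proof -
  note wp = w_power_in_sheet[of "nat (i - radius)"]
  have run: "foldl T' base (w [^]\<^bsub>F\<^esub> nat (i - radius)) = (x0, i)"
    using wp assms by simp
  show "base_path x i \<in> carrier F" using w q assms by (simp add: base_path_def)
  show "foldl T' base (base_path x i) = (x, i)"
    unfolding base_path_def cov.run_mult run using q[OF assms(1)] by (simp add: run_cover)
  have "fl.L (x0, i) (q x) = y [^]\<^bsub>Q\<^esub> yl.L (x0, i) (q x)"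
    using assms by (intro label_in_sheet radius_bounds) auto
  then have "fl.L base (base_path x i) = y [^]\<^bsub>Q\<^esub> yl.L base (base_path x i)"
    using wp run assms
    by (simp add: base_path_def fl.label_mult yl.label_mult Q.int_pow_mult)
  then show "fl.L base (base_path x i) = \<one>\<^bsub>Q\<^esub>"
    using f_base_paths[OF assms] by (simp add: base_path_def)
qed

lemma t_loop: "\<exists>h\<in>carrier F. key (foldl T' base h) = key base \<and> fl.L base h = t"
proof -
  \<comment> \<open>The last sheet to which \<open>base_path\<close> applies. From there
    \<open>2 * radius + 1\<close> copies of \<open>w\<close> lead to \<open>base\<close> shifted by
    one period, with one net crossing of the cut and without touching the zone.\<close>
  define j where "j = period - radius - 1"
  have j: "radius \<le> j" "j < period - radius" using radius_period radius_nonneg by (auto simp: j_def)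
  have pow: "foldl T' (x0, j) (w [^]\<^bsub>F\<^esub> m) = (x0, j + int m) \<and>
      fl.L (x0, j) (w [^]\<^bsub>F\<^esub> m) = t [^]\<^bsub>Q\<^esub> ((j + int m) div period)" if "int m \<le> 2 * radius + 1" for m
    using that
  proof (induction m)
    case 0
    have "j div period = 0" using j radius_nonneg by (intro div_pos_pos_trivial) auto
    then show ?case by (simp add: cov.run_one fl.label_one)
  next
    case (Suc m)
    have "fl.L (x0, j + int m) w = t [^]\<^bsub>Q\<^esub> (snd (foldl T' (x0, j + int m) w) div period - (j + int m) div period)"
    proof (intro label_near_cut radius_bounds(2))
      fix i assume "\<bar>i - (j + int m)\<bar> \<le> radius"
      then show "i mod period \<notin> zone"
        using Suc.prems by (intro not_zoneI) (auto simp: margin_def j_def)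
    qed
    then show ?case
      using Suc run_w
      by (simp add: cov.run_mult fl.label_mult Q.int_pow_mult[symmetric] add_ac)
  qed
  define m where "m = nat (2 * radius + 1)"
  have m: "int m = 2 * radius + 1" using radius_nonneg by (simp add: m_def)
  have end_j: "j + int m = period + radius" by (simp add: m j_def)
  let ?h = "base_path x0 j \<otimes>\<^bsub>F\<^esub> w [^]\<^bsub>F\<^esub> m"
  note bp = base_path[OF V(2) j]
  have p: "foldl T' (x0, j) (w [^]\<^bsub>F\<^esub> m) = (x0, period + radius) \<and>
      fl.L (x0, j) (w [^]\<^bsub>F\<^esub> m) = t [^]\<^bsub>Q\<^esub> ((period + radius) div period)"
    using pow[of m] unfolding end_j by (simp add: m)
  have "(period + radius) div period = 1"
    using radius_period radius_nonneg by (simp add: div_add_self1)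
  then have "fl.L base ?h = t"
    using p bp by (simp add: fl.label_mult)
  moreover have "key (foldl T' base ?h) = key base"
    using p bp by (simp add: cov.run_mult)
  moreover have "?h \<in> carrier F" using bp w by simp
  ultimately show ?thesis by blast
qed

text \<open>An edge \<open>e\<close> in the zone, closed up by two base paths of trivial label, has
  label \<open>y\<close> to the power \<open>f e\<close>. These exponents have gcd 1.\<close>

lemma y_loop: "\<exists>h\<in>carrier F. key (foldl T' base h) = key base \<and> fl.L base h = y"
proof -
  define I where "I = {e :: int. \<exists>h\<in>carrier F. foldl T' base h = base \<and> fl.L base h = y [^]\<^bsub>Q\<^esub> e}"
  have "Gcd (f ` ((V \<times> {..<n}) \<times> zone)) \<in> I"
  proof (rule Gcd_in_subgroup)
    show "0 \<in> I" unfolding I_def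
      using cov.run_one fl.label_one by (intro CollectI bexI[of _ "\<one>\<^bsub>F\<^esub>"]) auto
    fix a b assume "a \<in> I" "b \<in> I"
    then obtain h h' where h: "h \<in> carrier F" "foldl T' base h = base" "fl.L base h = y [^]\<^bsub>Q\<^esub> a"
      and h': "h' \<in> carrier F" "foldl T' base h' = base" "fl.L base h' = y [^]\<^bsub>Q\<^esub> b"
      by (auto simp: I_def)
    have "foldl T' base (h \<otimes>\<^bsub>F\<^esub> inv\<^bsub>F\<^esub> h') = base"
      using cov.run_inv(1)[OF h'(1), of base] h h' by (simp add: cov.run_mult)
    moreover have "fl.L base (h \<otimes>\<^bsub>F\<^esub> inv\<^bsub>F\<^esub> h') = y [^]\<^bsub>Q\<^esub> (a - b)"
      using fl.label_inv(1)[OF h'(1), of base] h h'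
      by (simp add: fl.label_mult Q.int_pow_diff)
    ultimately show "a - b \<in> I" unfolding I_def using h h' by blast
  next
    show "f ` ((V \<times> {..<n}) \<times> zone) \<subseteq> I"
    proof (rule image_subsetI)
      fix e assume "e \<in> (V \<times> {..<n}) \<times> zone"
      then obtain x a i where e: "e = ((x, a), i)" and x: "x \<in> V" and a: "a < n" and i: "i \<in> zone"
        by auto
      define x' i' where "x' = T x (a, True)" and "i' = i + \<chi> x a"
      have x': "x' \<in> V" using x V by (simp add: x'_def)
      have T'x: "T' (x, i) (a, True) = (x', i')" by (simp add: cover_def edge_label_def x'_def i'_def)
      have i1: "radius \<le> i" "i < period - radius" using i radius_nonneg by (auto simp: margin_def)
      \<comment> \<open>A single edge shifts the sheet by at most \<open>radius\<close>, so a base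
        path also reaches its end point.\<close>
      have "\<bar>\<chi> x a\<bar> \<le> radius" using abs_chi_le[of x a] radius_bounds(4) by linarith
      then have i2: "radius \<le> i'" "i' < period - radius" using i radius_nonneg by (auto simp: margin_def i'_def)
      note p = base_path[OF x i1] and p' = base_path[OF x' i2]
      have "i div period = 0" "i' div period = 0"
        using i1 i2 radius_nonneg by (auto intro!: div_pos_pos_trivial)
      moreover have "i mod period = i" using i1 radius_nonneg by simp
      ultimately have lab: "freelabel f (x, i) a = y [^]\<^bsub>Q\<^esub> f e"
        using i by (simp add: freelabel_def ylabel_def T'x e)
      have aF: "[(a, True)] \<in> carrier F" using a by (simp add: free_group_def reduced_Cons)
      let ?h = "base_path x i \<otimes>\<^bsub>F\<^esub> [(a, True)] \<otimes>\<^bsub>F\<^esub> inv\<^bsub>F\<^esub> base_path x' i'"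
      have inv: "foldl T' (x', i') (inv\<^bsub>F\<^esub> base_path x' i') = base"
          "fl.L (x', i') (inv\<^bsub>F\<^esub> base_path x' i') = \<one>\<^bsub>Q\<^esub>"
        using cov.run_inv(1)[OF p'(1), of base] fl.label_inv(1)[OF p'(1), of base] p' by simp_all
      have "foldl T' base ?h = base" using p inv by (simp add: cov.run_mult T'x)
      moreover have "fl.L base ?h = y [^]\<^bsub>Q\<^esub> f e"
        using p inv lab by (simp add: cov.run_mult fl.label_mult T'x edge_label_def)
      moreover have "?h \<in> carrier F" using p p' aF by simp
      ultimately show "f e \<in> I" unfolding I_def by blast
    qed
  qed (use V in auto)
  then have "1 \<in> I" by (simp only: f_primitive)
  then obtain h where h: "h \<in> carrier F" "foldl T' base h = base" "fl.L base h = y [^]\<^bsub>Q\<^esub> (1 :: int)"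
    unfolding I_def by blast
  then have "fl.L base h = y" using Q.int_pow_1[OF gens_closed(2)] by metis
  then show ?thesis using h by (intro bexI[of _ h]) simp_all
qed

end

section \<open>Counting equations in the cyclic cover\<close>

context commutator_character
begin

lemma linear_form_ylabel:
  assumes "s \<in> V \<times> UNIV" "h \<in> carrier F"
  shows "linear_form ((V \<times> {..<n}) \<times> zone) (\<lambda>f. path_label integer_group T' (ylabel f) s h)"
proof (rule linear_form_path_label[where A = "V \<times> UNIV" and S = "{..<n}"])
  fix s a assume "s \<in> V \<times> (UNIV :: int set)" "a \<in> {..<n}"
  then show "linear_form ((V \<times> {..<n}) \<times> zone) (\<lambda>f. ylabel f s a)"
    using V(1) by (cases "snd s mod period \<in> zone")
      (auto simp: ylabel_def mem_Times_iff intro!: linear_form_proj linear_form_zero)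
qed (use assms letters_bound V in \<open>auto simp: cover_def\<close>)

text \<open>As \<open>\<chi>\<close> kills \<open>u\<close> and \<open>v\<close>, they remain loops
  at every lift of \<open>x0\<close>, and the lift of \<open>r0\<close> there is a commutator of
  loops. Its integer label vanishes for every labelling: these are the equations gained.\<close>

lemma relator_label_base:
  "path_label integer_group T' g (x0, i) r0 = 0"
proof -
  interpret I: labelled_action integer_group T' g by (rule cov.labelled_action_int)
  have "foldl T' (x0, i) r0 = (x0, i)"
    using relators_fix[OF r0(2) V(2)] chi_relator[OF V(2) r0(2)] by (simp add: run_cover)
  moreover have "foldl T' (x0, i) u = (x0, i)" "foldl T' (x0, i) v = (x0, i)"
    using uv_fix chi_uv by (simp_all add: run_cover)
  ultimately show ?thesis using I.label_commutator[OF uv r0(1), of "(x0, i)"] by simp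
qed

lemma exists_free_cover: "\<exists>f. free_cover T n R u v r0 V x0 \<chi> w q f"
proof -
  interpret F: group F by (rule group_free_group)
  let ?U = "(V \<times> {..<n}) \<times> zone" and ?R = "set R - {r0}" and ?P = "{0..<period}"
  let ?d = "int (card V)"
  define eq where "eq s h = (\<lambda>f. path_label integer_group T' (ylabel f) s h)" for s h
  define p where "p x i = w [^]\<^bsub>F\<^esub> nat (i - radius) \<otimes>\<^bsub>F\<^esub> q x" for x i
  \<comment> \<open>The void equations for \<open>r0\<close> over \<open>x0\<close> are left out.
    There remain at most \<open>(card ?R + 2) * ?d * period - period\<close> equations in
    \<open>n * ?d * (period - 2 * margin)\<close> unknowns.\<close>
  define E where "E = (\<lambda>(r, s). eq s r) ` (?R \<times> (V \<times> ?P)) \<union> (\<lambda>s. eq s r0) ` ((V - {x0}) \<times> ?P)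
    \<union> (\<lambda>(x, i). eq base (p x i)) ` (V \<times> ?P)"
  have fin: "finite E" using V by (simp add: E_def)
  have per: "period > 0" using period_gt radius_nonneg by (simp add: margin_def)
  have "card E \<le> card ((\<lambda>(r, s). eq s r) ` (?R \<times> (V \<times> ?P)))
      + card ((\<lambda>s. eq s r0) ` ((V - {x0}) \<times> ?P)) + card ((\<lambda>(x, i). eq base (p x i)) ` (V \<times> ?P))"
    unfolding E_def by (intro order.trans[OF card_Un_le] add_mono order.refl)
  also have "\<dots> \<le> card (?R \<times> (V \<times> ?P)) + card ((V - {x0}) \<times> ?P) + card (V \<times> ?P)"
    using V by (intro add_mono card_image_le) auto
  finally have "int (card E) \<le> int (card (?R \<times> (V \<times> ?P)) + card ((V - {x0}) \<times> ?P) + card (V \<times> ?P))"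
    by (rule of_nat_mono)
  also have "\<dots> = int (card ?R) * (?d * period) + (?d - 1) * period + ?d * period"
    using V per card_V_pos by (simp add: card_cartesian_product of_nat_diff)
  also have "\<dots> = (int (card ?R) + 2) * (?d * period) - period"
    by (simp add: algebra_simps)
  also have "\<dots> \<le> int n * (?d * period) - period"
    using card_relators per by (intro diff_right_mono mult_right_mono) auto
  also have "\<dots> < int n * ?d * (period - 2 * margin)"
    by (simp add: period_def algebra_simps)
  also have "\<dots> = int (card ?U)"
    using period_gt by (simp add: card_cartesian_product)
  finally have card: "card E < card ?U" by simp
  have carr: "r \<in> carrier F" if "r \<in> set R" for r using relators that by blast
  have p: "p x i \<in> carrier F" if "x \<in> V" for x i using q w that by (simp add: p_def)
  have lin: "linear_form ?U l" if "l \<in> E" for l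
    using that V carr r0(2) p unfolding E_def eq_def
    by (auto intro!: linear_form_ylabel)
  have "finite ?U" using V by simp
  then obtain f where f: "\<And>e. e \<notin> ?U \<Longrightarrow> f e = 0" "\<And>l. l \<in> E \<Longrightarrow> l f = 0" "Gcd (f ` ?U) = 1"
    by (rule exists_primitive_solution[OF _ fin card]) (erule lin, (rule that; blast))
  have eq0: "path_label integer_group T' (ylabel f) s h = 0" if "eq s h \<in> E" for s h
    using f(2)[OF that] by (simp add: eq_def)
  have "free_cover T n R u v r0 V x0 \<chi> w q f"
  proof (unfold_locales)
    fix x i r assume xi: "x \<in> V" "0 \<le> i" "i < period" "r \<in> set R"
    show "path_label integer_group T' (ylabel f) (x, i) r = 0"
    proof (cases "r = r0 \<and> x = x0")
      case True
      then show ?thesis by (simp add: relator_label_base)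
    next
      case False
      then have "eq (x, i) r \<in> E"
        using xi unfolding E_def by (cases "r = r0") force+
      then show ?thesis by (rule eq0)
    qed
  next
    fix x i assume "x \<in> V" "radius \<le> i" "i < period - radius"
    then have "eq base (p x i) \<in> E" using radius_nonneg unfolding E_def by force
    then show "path_label integer_group T' (ylabel f) base (w [^]\<^bsub>F\<^esub> nat (i - radius) \<otimes>\<^bsub>F\<^esub> q x) = 0"
      unfolding p_def by (rule eq0)
  qed (rule f(3))
  then show ?thesis by blast
qed

end

lemma (in presentation) large_if_commutator_action:
  assumes "commutator_action T n R u v r0 V x0" "card V \<ge> 2"
  shows "large G"
proof -
  interpret A: commutator_action T n R u v r0 V x0 by fact
  obtain \<chi> where chi: "\<And>x a. x \<notin> V \<or> a \<ge> n \<Longrightarrow> \<chi> x a = 0"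
      "\<And>x r. x \<in> V \<Longrightarrow> r \<in> set R \<Longrightarrow> A.intlabel \<chi> x r = 0"
      "A.intlabel \<chi> x0 u = 0" "A.intlabel \<chi> x0 v = 0"
    and w: "\<exists>w\<in>carrier (free_group_rank n). foldl T x0 w = x0 \<and> A.intlabel \<chi> x0 w = 1"
    and q: "\<And>x. x \<in> V \<Longrightarrow> \<exists>q\<in>carrier (free_group_rank n). foldl T x0 q = x \<and> A.intlabel \<chi> x0 q = 0"
    by (rule A.exists_character[OF assms(2)]) (rule that; blast)
  from w obtain w where w: "w \<in> carrier (free_group_rank n)" "foldl T x0 w = x0" "A.intlabel \<chi> x0 w = 1"
    by blast
  from q have "\<forall>x\<in>V. \<exists>q. q \<in> carrier (free_group_rank n) \<and> foldl T x0 q = x \<and> A.intlabel \<chi> x0 q = 0"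
    by blast
  then obtain q where q: "\<And>x. x \<in> V \<Longrightarrow> q x \<in> carrier (free_group_rank n) \<and> foldl T x0 (q x) = x \<and> A.intlabel \<chi> x0 (q x) = 0"
    by metis
  interpret C: commutator_character T n R u v r0 V x0 \<chi> w q
    using chi w q by unfold_locales auto
  obtain f where "free_cover T n R u v r0 V x0 \<chi> w q f" using C.exists_free_cover by blast
  then interpret D: free_cover T n R u v r0 V x0 \<chi> w q f .
  show ?thesis
  proof (rule large_if_periodic_action[OF D.fl.periodic_action_axioms, where A = "V \<times> UNIV"])
    show "C.T' s l \<in> V \<times> UNIV" if "s \<in> V \<times> UNIV" for s l
      using that A.V(3) by (simp add: cover_def mem_Times_iff)
    show "C.base \<in> V \<times> UNIV" using A.V by simp
    show "foldl C.T' s r = s \<and> D.fl.L s r = \<one>\<^bsub>C.Q\<^esub>" if "r \<in> set R" "s \<in> V \<times> UNIV" for r s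
      using D.relator_label[OF that(2,1)] by simp
    show "\<exists>h\<in>carrier C.F. C.key (foldl C.T' C.base h) = C.key C.base \<and> D.fl.L C.base h = [(a, True)]"
      if "a \<in> {0, 1}" for a
      using that D.t_loop D.y_loop by (elim insertE emptyE) (simp_all only:)
  qed
qed

section \<open>Subgroups of finite index\<close>

lemma (in group_hom) finite_index_vimage:
  assumes "subgroup K H" "finite (rcosets\<^bsub>H\<^esub> K)"
  shows "finite_index_subgroup {g \<in> carrier G. h g \<in> K} G"
proof -
  interpret K: subgroup K H by fact
  have sub: "subgroup {g \<in> carrier G. h g \<in> K} G"
    by (rule G.subgroupI) (auto intro!: exI[of _ "\<one>\<^bsub>G\<^esub>"])
  have "finite (rcosets\<^bsub>G\<^esub> {g \<in> carrier G. h g \<in> K})"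
  proof (rule G.finite_rcosetsI[OF sub, where f = "\<lambda>g. K #>\<^bsub>H\<^esub> h g"])
    show "finite ((\<lambda>g. K #>\<^bsub>H\<^esub> h g) ` carrier G)"
      by (rule finite_subset[OF _ assms(2)]) (auto intro!: H.rcosetsI K.subset)
    fix a b assume ab: "a \<in> carrier G" "b \<in> carrier G" "K #>\<^bsub>H\<^esub> h a = K #>\<^bsub>H\<^esub> h b"
    have "h a \<in> K #>\<^bsub>H\<^esub> h b"
      using H.rcos_self[of "h a" K] assms(1) ab by auto
    then show "a \<otimes>\<^bsub>G\<^esub> inv\<^bsub>G\<^esub> b \<in> {g \<in> carrier G. h g \<in> K}"
      using ab by (simp add: K.rcos_module[OF H.group_axioms])
  qed
  then show ?thesis using sub by (simp add: finite_index_subgroup_def)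
qed

text \<open>An element is recorded by its coset of \<open>H\<close> and by the coset of
  \<open>L\<close> of what is left after dividing by the representative \<open>r\<close>.\<close>

lemma (in group) finite_index_trans:
  assumes H: "finite_index_subgroup H G" and L: "subgroup L (G\<lparr>carrier := H\<rparr>)"
    and fin: "finite (rcosets\<^bsub>G\<lparr>carrier := H\<rparr>\<^esub> L)"
  shows "finite_index_subgroup L G"
proof -
  have H': "subgroup H G" "finite (rcosets H)" using H by (auto simp: finite_index_subgroup_def)
  interpret H: subgroup H G by (rule H'(1))
  interpret GH: group "G\<lparr>carrier := H\<rparr>" by (rule subgroup_imp_group[OF H'(1)])
  interpret L: subgroup L "G\<lparr>carrier := H\<rparr>" by (rule L)
  have sub: "subgroup L G" using incl_subgroup[OF H'(1) L] .
  interpret LG: subgroup L G by (rule sub)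
  define r where "r c = (SOME x. x \<in> c)" for c :: "'a set"
  have r: "r (H #> g) \<in> carrier G \<and> g \<otimes> inv (r (H #> g)) \<in> H" if g: "g \<in> carrier G" for g
  proof -
    have *: "r (H #> g) \<in> H #> g"
      unfolding r_def using rcos_self[OF g H'(1)] by (rule someI)
    then have c: "r (H #> g) \<in> carrier G"
      using r_coset_subset_G[OF H.subset g] by blast
    have "H #> g = H #> r (H #> g)" by (rule repr_independence[OF * g H'(1)])
    then have "g \<in> H #> r (H #> g)" using rcos_self[OF g H'(1)] by simp
    then show ?thesis using H.rcos_module[OF group_axioms c g] c by simp
  qed
  have "finite (rcosets L)"
  proof (rule finite_rcosetsI[OF sub, where f = "\<lambda>g. (H #> g, L #> (g \<otimes> inv (r (H #> g))))"])
    show "finite ((\<lambda>g. (H #> g, L #> (g \<otimes> inv (r (H #> g))))) ` carrier G)"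
    proof (rule finite_subset)
      show "(\<lambda>g. (H #> g, L #> (g \<otimes> inv (r (H #> g))))) ` carrier G
          \<subseteq> (rcosets H) \<times> (rcosets\<^bsub>G\<lparr>carrier := H\<rparr>\<^esub> L)"
        using r by (auto simp: RCOSETS_def r_coset_def)
    qed (use fin H' in simp)
    fix a b assume ab: "a \<in> carrier G" "b \<in> carrier G"
      and "(H #> a, L #> (a \<otimes> inv (r (H #> a)))) = (H #> b, L #> (b \<otimes> inv (r (H #> b))))"
    then have Hab: "H #> a = H #> b"
      and eq: "L #> (a \<otimes> inv (r (H #> b))) = L #> (b \<otimes> inv (r (H #> b)))" by auto
    note rb = r[OF ab(2)]
    have "a \<otimes> inv (r (H #> b)) \<in> L #> (b \<otimes> inv (r (H #> b)))"
      using rcos_self[OF _ sub, of "a \<otimes> inv (r (H #> b))"] ab rb unfolding eq by simp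
    then have "a \<otimes> inv (r (H #> b)) \<otimes> inv (b \<otimes> inv (r (H #> b))) \<in> L"
      using LG.rcos_module[OF group_axioms] ab rb by simp
    moreover have "inv x \<otimes> (x \<otimes> z) = z" if "x \<in> carrier G" "z \<in> carrier G" for x z
      using that by (simp flip: m_assoc)
    ultimately show "a \<otimes> inv b \<in> L"
      using ab rb by (simp add: inv_mult_group m_assoc)
  qed
  then show ?thesis using sub by (simp add: finite_index_subgroup_def)
qed

text \<open>If \<open>B\<close> with \<open>a\<close> adjoined is still proper, induction applies to
  it. Otherwise the quotient by \<open>B\<close> is a nontrivial cyclic group, which has a proper
  subgroup of finite index.\<close>

lemma (in comm_group) exists_finite_index_subgroup:
  assumes "finite A" "A \<subseteq> carrier G" "subgroup B G" "B \<noteq> carrier G"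
    and "generate G (B \<union> A) = carrier G"
  shows "\<exists>K. finite_index_subgroup K G \<and> B \<subseteq> K \<and> K \<noteq> carrier G"
  using assms
proof (induction A arbitrary: B rule: finite_induct)
  case empty
  then have "generate G B \<subseteq> B" by (intro generate_subgroup_incl) auto
  then show ?case using empty.prems(4) subgroup.subset[OF empty.prems(2)] empty.prems(3) by auto
next
  case (insert a A)
  interpret B: subgroup B G by fact
  have a: "a \<in> carrier G" using insert.prems by simp
  \<comment> \<open>The product of \<open>B\<close> with the cyclic subgroup generated by
    \<open>a [^] p\<close>.\<close>
  define M where "M p = {g \<in> carrier G. \<exists>i :: int. g \<otimes> a [^] (p * i) \<in> B}" for p
  have M_sub: "subgroup (M p) G" for p
  proof (rule subgroupI)
    show "M p \<noteq> {}" using B.one_closed a by (auto simp: M_def intro!: exI[of _ \<one>] exI[of _ 0])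
    fix g assume "g \<in> M p"
    then obtain i where i: "g \<in> carrier G" "g \<otimes> a [^] (p * i) \<in> B" by (auto simp: M_def)
    have "inv (g \<otimes> a [^] (p * i)) \<in> B" using i by simp
    then have "inv g \<otimes> a [^] (p * (- i)) \<in> B" using i a by (simp add: inv_mult int_pow_neg)
    then show "inv g \<in> M p" using i unfolding M_def by blast
    fix h assume "h \<in> M p"
    then obtain j where j: "h \<in> carrier G" "h \<otimes> a [^] (p * j) \<in> B" by (auto simp: M_def)
    have "g \<otimes> a [^] (p * i) \<otimes> (h \<otimes> a [^] (p * j)) \<in> B" using i j by simp
    moreover have "g \<otimes> a [^] (p * i) \<otimes> (h \<otimes> a [^] (p * j)) = g \<otimes> h \<otimes> a [^] (p * (i + j))"
      using i j a by (simp add: distrib_left int_pow_mult m_ac)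
    ultimately show "g \<otimes> h \<in> M p" using i j unfolding M_def by auto
  qed (auto simp: M_def)
  have B_M: "B \<subseteq> M p" for p
    using B.subset by (auto simp: M_def intro!: exI[of _ 0])
  have a_M1: "a \<in> M 1"
    using a B.one_closed int_pow_neg[OF a, of 1] by (auto simp: M_def intro!: exI[of _ "- 1"])
  show ?case
  proof (cases "M 1 = carrier G")
    case False
    have "carrier G \<subseteq> generate G (M 1 \<union> A)"
      unfolding insert.prems(4)[symmetric] using B_M a_M1 by (intro mono_generate) auto
    moreover have "generate G (M 1 \<union> A) \<subseteq> carrier G"
      using subgroup.subset[OF M_sub] insert.prems(1) by (intro generate_incl) auto
    ultimately have "generate G (M 1 \<union> A) = carrier G" by blast
    moreover have "A \<subseteq> carrier G" using insert.prems(1) by simp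
    ultimately obtain K where "finite_index_subgroup K G" "M 1 \<subseteq> K" "K \<noteq> carrier G"
      using insert.IH[OF _ M_sub False] by blast
    then show ?thesis using B_M by blast
  next
    case True
    then have cyclic: "\<exists>i :: int. g \<otimes> a [^] i \<in> B" if "g \<in> carrier G" for g
      using that by (auto simp: M_def)
    define e where "e g = (SOME i :: int. g \<otimes> a [^] i \<in> B)" for g
    have e: "g \<otimes> a [^] e g \<in> B" if "g \<in> carrier G" for g
      unfolding e_def using cyclic[OF that] by (rule someI_ex)
    have fin: "finite (rcosets (M p))" if p: "p > 0" for p
    proof (rule finite_rcosetsI[OF M_sub, where f = "\<lambda>g. e g mod p"])
      show "finite ((\<lambda>g. e g mod p) ` carrier G)"
        by (rule finite_subset[of _ "{0..<p}"]) (use p in auto)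
      fix g h assume gh: "g \<in> carrier G" "h \<in> carrier G" "e g mod p = e h mod p"
      then obtain k where k: "e g = e h + p * k"
        by (metis mod_eq_dvd_iff dvd_def add.commute diff_add_cancel)
      have "g \<otimes> a [^] e g \<otimes> inv (h \<otimes> a [^] e h) \<in> B" using e gh by simp
      moreover have "g \<otimes> a [^] e g \<otimes> inv (h \<otimes> a [^] e h) = g \<otimes> inv h \<otimes> (a [^] e g \<otimes> inv (a [^] e h))"
        using gh a by (simp add: inv_mult m_ac)
      moreover have "a [^] e g \<otimes> inv (a [^] e h) = a [^] (p * k)"
        using a by (simp add: k int_pow_diff[symmetric])
      ultimately show "g \<otimes> inv h \<in> M p" using gh unfolding M_def by auto
    qed
    show ?thesis
    \<comment> \<open>If \<open>B\<close> and \<open>a [^] 2\<close> generate everything, an odd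
      power of \<open>a\<close> lies in \<open>B\<close>. Its exponent is nonzero, so the cyclic
      quotient is finite and \<open>B\<close> itself has finite index.\<close>
    proof (cases "M 2 = carrier G")
      case False
      then show ?thesis using fin[of 2] M_sub[of 2] B_M[of 2] by (intro exI[of _ "M 2"]) (simp add: finite_index_subgroup_def)
    next
      case True
      then obtain i :: int where i: "a \<otimes> a [^] (2 * i) \<in> B" using a by (auto simp: M_def)
      define p where "p = \<bar>1 + 2 * i\<bar>"
      have p: "p > 0" by (simp add: p_def) presburger
      have "a [^] (1 + 2 * i) \<in> B" using i a by (simp add: int_pow_mult)
      then have ap: "a [^] p \<in> B"
        using a B.m_inv_closed int_pow_neg[OF a, of "1 + 2 * i"] by (auto simp: p_def abs_if)
      have "M p \<subseteq> B"
      proof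
        fix g assume "g \<in> M p"
        then obtain j where j: "g \<in> carrier G" "g \<otimes> a [^] (p * j) \<in> B" by (auto simp: M_def)
        have "(a [^] p) [^] (- j) \<in> B" by (rule subgroup_int_pow_closed[OF insert.prems(2) ap])
        then have "a [^] (- (p * j)) \<in> B" using a by (simp add: int_pow_pow)
        then have "g \<otimes> a [^] (p * j) \<otimes> a [^] (- (p * j)) \<in> B" using j by simp
        then show "g \<in> B" using j a by (simp add: m_assoc int_pow_mult[symmetric])
      qed
      then have "M p = B" using B_M by blast
      then show ?thesis
        using fin[OF p] insert.prems(2,3) by (auto simp: finite_index_subgroup_def)
    qed
  qed
qed

section \<open>Integer-valued homomorphisms, cosets and centralizers\<close>

lemma (in group) finite_index_dvd:
  assumes "\<psi> \<in> hom G integer_group" "m > 0"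
  shows "finite_index_subgroup {g \<in> carrier G. m dvd \<psi> g} G"
proof -
  interpret psi: group_hom G integer_group \<psi>
    using assms(1) by (simp add: group_hom_def group_hom_axioms_def group_axioms)
  have sub: "subgroup {g \<in> carrier G. m dvd \<psi> g} G"
    using psi.hom_one by (intro subgroupI) (auto intro!: exI[of _ \<one>])
  have "finite (rcosets {g \<in> carrier G. m dvd \<psi> g})"
  proof (rule finite_rcosetsI[OF sub, where f = "\<lambda>g. \<psi> g mod m"])
    show "finite ((\<lambda>g. \<psi> g mod m) ` carrier G)"
      by (rule finite_subset[of _ "{0..<m}"]) (use assms(2) in auto)
  qed (auto simp: mod_eq_dvd_iff)
  then show ?thesis using sub by (simp add: finite_index_subgroup_def)
qed

lemma (in group) hom_integer_derived:
  assumes "\<psi> \<in> hom G integer_group" "g \<in> derived G (carrier G)"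
  shows "\<psi> g = 0"
proof -
  interpret psi: group_hom G integer_group \<psi>
    using assms(1) by (simp add: group_hom_def group_hom_axioms_def group_axioms)
  have "subgroup {g \<in> carrier G. \<psi> g = 0} G"
    using psi.hom_one by (intro subgroupI) (auto intro!: exI[of _ \<one>])
  then have "derived G (carrier G) \<subseteq> {g \<in> carrier G. \<psi> g = 0}"
    unfolding derived_def by (intro generate_subgroup_incl) auto
  then show ?thesis using assms(2) by blast
qed

lemma (in group) rcosets_r_coset:
  assumes "subgroup K G" "x \<in> rcosets K" "g \<in> carrier G"
  shows "x \<subseteq> carrier G" "x #> g \<in> rcosets K"
proof -
  obtain h where h: "h \<in> carrier G" "x = K #> h" using assms(2) unfolding RCOSETS_def by blast
  have K: "K \<subseteq> carrier G" using assms(1) by (rule subgroup.subset)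
  show "x \<subseteq> carrier G" using h K by (simp add: r_coset_subset_G)
  show "x #> g \<in> rcosets K" using h K assms(3) by (simp add: coset_mult_assoc rcosetsI)
qed

lemma (in group) subgroup_centralizer:
  assumes "A \<subseteq> carrier G"
  shows "subgroup {g \<in> carrier G. \<forall>x\<in>A. g \<otimes> x = x \<otimes> g} G"
proof (rule subgroupI)
  show "{g \<in> carrier G. \<forall>x\<in>A. g \<otimes> x = x \<otimes> g} \<noteq> {}"
    using assms by (auto intro!: exI[of _ \<one>])
  fix g assume g: "g \<in> {g \<in> carrier G. \<forall>x\<in>A. g \<otimes> x = x \<otimes> g}"
  have "inv g \<otimes> x = x \<otimes> inv g" if "x \<in> A" for x
  proof -
    have x: "x \<in> carrier G" "g \<otimes> x = x \<otimes> g" "g \<in> carrier G" using g that assms by auto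
    have "inv g \<otimes> (g \<otimes> x) \<otimes> inv g = inv g \<otimes> (x \<otimes> g) \<otimes> inv g" using x by simp
    moreover have "inv g \<otimes> (g \<otimes> x) = x" using x(1,3) by (simp flip: m_assoc)
    moreover have "inv g \<otimes> (x \<otimes> g) \<otimes> inv g = inv g \<otimes> x" using x(1,3) by (simp add: m_assoc)
    ultimately show ?thesis by simp
  qed
  then show "inv g \<in> {g \<in> carrier G. \<forall>x\<in>A. g \<otimes> x = x \<otimes> g}" using g by auto
  fix h assume h: "h \<in> {g \<in> carrier G. \<forall>x\<in>A. g \<otimes> x = x \<otimes> g}"
  have "g \<otimes> h \<otimes> x = x \<otimes> (g \<otimes> h)" if "x \<in> A" for x
  proof -
    have "x \<in> carrier G" using that assms by blast
    moreover have "g \<otimes> x = x \<otimes> g" "h \<otimes> x = x \<otimes> h" "g \<in> carrier G" "h \<in> carrier G"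
      using g h that by auto
    ultimately show ?thesis by (metis m_assoc)
  qed
  then show "g \<otimes> h \<in> {g \<in> carrier G. \<forall>x\<in>A. g \<otimes> x = x \<otimes> g}" using g h by auto
qed auto

text \<open>The centralizer of \<open>A\<close> contains the generated group. Hence \<open>A\<close>
  lies in the centralizer of the generated group, and the argument is repeated.\<close>

lemma (in group) generate_commute:
  assumes "A \<subseteq> carrier G" "\<And>x y. x \<in> A \<Longrightarrow> y \<in> A \<Longrightarrow> x \<otimes> y = y \<otimes> x"
    and "g \<in> generate G A" "h \<in> generate G A"
  shows "g \<otimes> h = h \<otimes> g"
proof -
  let ?C = "\<lambda>A. {g \<in> carrier G. \<forall>x\<in>A. g \<otimes> x = x \<otimes> g}"
  have 1: "generate G A \<subseteq> ?C A"
    by (rule generate_subgroup_incl[OF _ subgroup_centralizer[OF assms(1)]]) (use assms in auto)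
  have "generate G A \<subseteq> carrier G" by (rule generate_incl[OF assms(1)])
  then have "generate G A \<subseteq> ?C (generate G A)"
    by (intro generate_subgroup_incl[OF _ subgroup_centralizer]) (use assms 1 in auto)
  then show ?thesis using assms by blast
qed

section \<open>Commutators outside a finite index subgroup of a large group\<close>

lemma free_group_not_comm_letters:
  assumes "\<not> comm_group (free_group S)"
  obtains a b where "a \<in> S" "b \<in> S" "a \<noteq> b"
proof (rule ccontr)
  note obtained = that
  assume "\<not> thesis"
  then have eq: "a = b" if "a \<in> S" "b \<in> S" for a b using that obtained by blast
  interpret F: group "free_group S" by (rule group_free_group)
  let ?A = "(\<lambda>a. [(a, True)]) ` S"
  have A: "?A \<subseteq> carrier (free_group S)" by (auto simp: free_group_def reduced_Cons)
  have gen: "generate (free_group S) ?A = carrier (free_group S)"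
    by (rule free_group_singleton_closed[OF F.generate_is_subgroup[OF A]]) (auto intro: generate.incl)
  have "comm_group (free_group S)"
    by (rule F.group_comm_groupI, rule F.generate_commute[OF A])
      (use eq in \<open>auto simp: gen\<close>)
  with assms show False ..
qed

text \<open>The letters \<open>a\<close> and \<open>b\<close> act on three points as two non-commuting transpositions.\<close>

lemma free_group_finite_index_commutator:
  assumes "a \<in> S" "b \<in> S" "a \<noteq> b"
  obtains M g h where "subgroup M (free_group S)" "finite (rcosets\<^bsub>free_group S\<^esub> M)"
    and "g \<in> carrier (free_group S)" "h \<in> carrier (free_group S)"
    and "g \<otimes>\<^bsub>free_group S\<^esub> h \<otimes>\<^bsub>free_group S\<^esub> inv\<^bsub>free_group S\<^esub> g \<otimes>\<^bsub>free_group S\<^esub> inv\<^bsub>free_group S\<^esub> h \<notin> M"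
proof -
  let ?F = "free_group S"
  define T :: "nat \<Rightarrow> 'a letter \<Rightarrow> nat" where
    "T x l = (if fst l = a then Transposition.transpose 0 1 x
      else if fst l = b then Transposition.transpose 1 2 x else x)" for x l
  interpret P: state_action T by unfold_locales (auto simp: T_def)
  have closed: "foldl T x w \<in> {0, 1, 2}" if "x \<in> {0, 1, 2}" for x w
    using that
  proof (induction w arbitrary: x)
    case (Cons l w)
    have "T x l \<in> {0, 1, 2}" using Cons.prems by (auto simp: T_def Transposition.transpose_def)
    from Cons.IH[OF this] show ?case by simp
  qed simp
  have fin: "finite ((\<lambda>w. id (foldl T 0 w)) ` carrier ?F)"
    by (rule finite_subset[of _ "{0, 1, 2}"]) (use closed[of 0] in \<open>simp_all add: image_subset_iff\<close>)
  interpret Q: periodic_action integer_group T "\<lambda>_ _. 0" id S 0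
    by (intro periodic_action.intro periodic_action_axioms.intro P.labelled_action_int fin) auto
  have ab: "[(a, True)] \<in> carrier ?F" "[(b, True)] \<in> carrier ?F"
    using assms by (auto simp: free_group_def reduced_Cons)
  have inv: "foldl T x (inv\<^bsub>?F\<^esub> [(c, True)]) = T x (c, True)" if "[(c, True)] \<in> carrier ?F" for c x
  proof -
    have "T (T x (c, True)) (c, True) = x" by (simp add: T_def)
    then show ?thesis using P.run_inv(1)[OF that, of "T x (c, True)"] by simp
  qed
  let ?c = "[(a, True)] \<otimes>\<^bsub>?F\<^esub> [(b, True)] \<otimes>\<^bsub>?F\<^esub> inv\<^bsub>?F\<^esub> [(a, True)] \<otimes>\<^bsub>?F\<^esub> inv\<^bsub>?F\<^esub> [(b, True)]"
  \<comment> \<open>Each transposition is its own inverse, and the path of the commutator runs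
    through 0, 1, 2, 2, 1.\<close>
  have "foldl T 0 ?c \<noteq> 0"
    using assms by (simp add: P.run_mult inv[OF ab(1)] inv[OF ab(2)])
      (simp add: T_def Transposition.transpose_def)
  then have "?c \<notin> Q.stab" by (simp add: Q.stab_def)
  then show thesis by (rule that[OF Q.subgroup_stab Q.finite_rcosets_stab ab])
qed

text \<open>A finite index subgroup of the free quotient that misses a commutator is pulled back to
  \<open>H\<close>, where it has finite index in \<open>G\<close> too. This separates large groups
  from abelian and from residually useless ones.\<close>

lemma (in group) large_not_derived_subset:
  assumes "large G"
  obtains K where "finite_index_subgroup K G" "\<not> derived G (carrier G) \<subseteq> K"
proof -
  obtain H and S :: "nat set" and \<phi> where H: "finite_index_subgroup H G"
    and S: "\<not> comm_group (free_group S)" and phi: "\<phi> \<in> epi (G\<lparr>carrier := H\<rparr>) (free_group S)"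
    using assms unfolding large_def by blast
  have sub: "subgroup H G" using H by (simp add: finite_index_subgroup_def)
  interpret H: subgroup H G by (rule sub)
  interpret phi: group_hom "G\<lparr>carrier := H\<rparr>" "free_group S" \<phi>
    using phi subgroup_imp_group[OF sub] group_free_group
    by (simp add: group_hom_def group_hom_axioms_def epi_def)
  obtain a b where ab: "a \<in> S" "b \<in> S" "a \<noteq> b" using free_group_not_comm_letters[OF S] .
  obtain M g h where M: "subgroup M (free_group S)" "finite (rcosets\<^bsub>free_group S\<^esub> M)"
    and gh: "g \<in> carrier (free_group S)" "h \<in> carrier (free_group S)"
    and notin: "g \<otimes>\<^bsub>free_group S\<^esub> h \<otimes>\<^bsub>free_group S\<^esub> inv\<^bsub>free_group S\<^esub> g \<otimes>\<^bsub>free_group S\<^esub> inv\<^bsub>free_group S\<^esub> h \<notin> M"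
    by (rule free_group_finite_index_commutator[OF ab])
  let ?L = "{x \<in> carrier (G\<lparr>carrier := H\<rparr>). \<phi> x \<in> M}"
  have "finite_index_subgroup ?L (G\<lparr>carrier := H\<rparr>)"
    by (rule phi.finite_index_vimage[OF M])
  then have L: "finite_index_subgroup ?L G"
    by (intro finite_index_trans[OF H]) (simp_all add: finite_index_subgroup_def)
  have "\<phi> ` H = carrier (free_group S)" using phi by (simp add: epi_def)
  then obtain x z where xz: "x \<in> H" "z \<in> H" "\<phi> x = g" "\<phi> z = h" using gh by (metis imageE)
  have "x \<otimes> z \<otimes> inv x \<otimes> inv z \<in> derived G (carrier G)"
    unfolding derived_def using xz H.subset by (intro generate.incl) blast
  moreover have "x \<otimes> z \<otimes> inv x \<otimes> inv z \<notin> ?L"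
  proof -
    have "\<phi> (x \<otimes> z \<otimes> inv x \<otimes> inv z) = g \<otimes>\<^bsub>free_group S\<^esub> h \<otimes>\<^bsub>free_group S\<^esub> inv\<^bsub>free_group S\<^esub> g \<otimes>\<^bsub>free_group S\<^esub> inv\<^bsub>free_group S\<^esub> h"
      using xz phi.hom_mult phi.hom_inv m_inv_consistent[OF sub] by simp
    then show ?thesis using notin by simp
  qed
  ultimately show thesis using that[OF L] by blast
qed

lemma (in comm_group) not_large: "\<not> large G"
proof
  assume "large G"
  then obtain K where K: "finite_index_subgroup K G" "\<not> derived G (carrier G) \<subseteq> K"
    by (rule large_not_derived_subset)
  then have "subgroup K G" by (simp add: finite_index_subgroup_def)
  then show False
    using K(2) derived_eq_singleton[of "carrier G"] subgroup.one_closed by fastforce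
qed

section \<open>Commutator relators\<close>

locale commutator_presentation = presentation +
  fixes u v r0 :: "nat letter list"
  assumes deficiency_one: "Suc (length R) = n"
    and uv: "u \<in> carrier (free_group_rank n)" "v \<in> carrier (free_group_rank n)"
    and r0: "r0 = u \<otimes>\<^bsub>free_group_rank n\<^esub> v \<otimes>\<^bsub>free_group_rank n\<^esub>
        inv\<^bsub>free_group_rank n\<^esub> u \<otimes>\<^bsub>free_group_rank n\<^esub> inv\<^bsub>free_group_rank n\<^esub> v"
      "r0 \<in> set R"
begin

lemma pi_relator: "r \<in> set R \<Longrightarrow> \<pi> r = \<one>"
proof -
  assume r: "r \<in> set R"
  then have "r \<in> normal_closure (free_group_rank n) (set R)"
    using relators by (auto simp: normal_closure_def)
  then show ?thesis using kernel_pi by (auto simp: kernel_def)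
qed

lemma pi_uv_closed [simp]: "\<pi> u \<in> carrier G" "\<pi> v \<in> carrier G"
  using uv by simp_all

lemma pi_uv_commute: "\<pi> u \<otimes> \<pi> v = \<pi> v \<otimes> \<pi> u"
proof -
  have "\<pi> u \<otimes> \<pi> v \<otimes> inv (\<pi> u) \<otimes> inv (\<pi> v) = \<one>"
    using pi_relator[OF r0(2)] uv by (simp add: r0(1))
  then have "\<pi> u \<otimes> \<pi> v \<otimes> inv (\<pi> u) = \<pi> v"
    using inv_equality[of "\<pi> u \<otimes> \<pi> v \<otimes> inv (\<pi> u)" "inv (\<pi> v)"] by simp
  then have "\<pi> u \<otimes> \<pi> v \<otimes> inv (\<pi> u) \<otimes> \<pi> u = \<pi> v \<otimes> \<pi> u" by simp
  then show ?thesis by (simp add: m_assoc)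
qed

text \<open>The free group acts on the right cosets of \<open>K\<close> through
  \<open>\<pi>\<close>. The coset \<open>K\<close> is fixed by \<open>u\<close> and
  \<open>v\<close>, and properness of \<open>K\<close> supplies a second vertex.\<close>

lemma large_if_proper_subgroup:
  assumes K: "finite_index_subgroup K G" "K \<noteq> carrier G" and uvK: "\<pi> u \<in> K" "\<pi> v \<in> K"
  shows "large G"
proof -
  let ?F = "free_group_rank n"
  have sub: "subgroup K G" and fin: "finite (rcosets K)"
    using K(1) by (auto simp: finite_index_subgroup_def)
  interpret K: subgroup K G by (rule sub)
  \<comment> \<open>All natural numbers occur as letters of the action; those outside the free group
    act trivially.\<close>
  define e where "e l = (if fst l < n then \<pi> [l] else \<one>)" for l
  have letter: "[l] \<in> carrier ?F" if "fst l < n" for l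
    using that by (simp add: free_group_def reduced_Cons)
  have e_closed: "e l \<in> carrier G" for l using letter by (simp add: e_def)
  have e_inv: "e l \<otimes> e (letter_inv l) = \<one>" for l
  proof (cases "fst l < n")
    case True
    have "[l] \<otimes>\<^bsub>?F\<^esub> [letter_inv l] = \<one>\<^bsub>?F\<^esub>"
      by (simp add: free_group_def word_mult_def)
    then have "\<pi> [l] \<otimes> \<pi> [letter_inv l] = \<one>"
      using pi.hom_mult[of "[l]" "[letter_inv l]"] True letter[of l] letter[of "letter_inv l"] by simp
    then show ?thesis using True by (simp add: e_def)
  qed (simp add: e_def)
  \<comment> \<open>Sets that are not cosets stay fixed, which keeps the action total on the
    type.\<close>
  define T where "T x l = (if x \<in> rcosets K then x #> e l else x)" for x l
  note cosets = rcosets_r_coset[OF sub]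
  have run: "foldl T x w = x #> \<pi> w" if "x \<in> rcosets K" "w \<in> carrier ?F" for x w
    using that
  proof (induction w arbitrary: x)
    case Nil
    have "\<pi> [] = \<one>" using pi.hom_one by (simp add: free_group_def)
    then show ?case using cosets(1)[OF Nil(1) one_closed] by simp
  next
    case (Cons l w)
    have l: "fst l < n" and w: "w \<in> carrier ?F" using Cons.prems(2) by (auto simp: free_group_def reduced_Cons)
    have "[l] \<otimes>\<^bsub>?F\<^esub> w = l # w"
      using Cons.prems by (cases w) (auto simp: free_group_def word_mult_def reduced_Cons)
    then have "\<pi> (l # w) = e l \<otimes> \<pi> w" using pi.hom_mult[OF letter[OF l] w] l by (simp add: e_def)
    moreover have "T x l = x #> e l" using Cons.prems(1) by (simp add: T_def)
    then have "foldl T x (l # w) = (x #> e l) #> \<pi> w"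
      using Cons.IH[OF cosets(2)[OF Cons.prems(1) e_closed] w] by simp
    ultimately show ?case
      using coset_mult_assoc[OF cosets(1)[OF Cons.prems(1) one_closed] e_closed, of "\<pi> w"] w by simp
  qed
  have K_in: "K \<in> rcosets K" using rcosetsI[OF K.subset one_closed] K.subset by simp
  have "commutator_action T n R u v r0 (rcosets K) K"
  proof
    show "T (T x l) (letter_inv l) = x" for x l
    proof (cases "x \<in> rcosets K")
      case True
      then have "T (T x l) (letter_inv l) = x #> e l #> e (letter_inv l)"
        using cosets(2)[OF True e_closed] by (simp add: T_def)
      also have "\<dots> = x"
        using cosets(1)[OF True one_closed] e_closed by (simp add: coset_mult_assoc e_inv)
      finally show ?thesis .
    qed (simp add: T_def)
    show "T x l \<in> rcosets K" if "x \<in> rcosets K" for x l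
      using cosets(2)[OF that e_closed] that by (simp add: T_def)
    show "foldl T x r = x" if "r \<in> set R" "x \<in> rcosets K" for r x
    proof -
      have "foldl T x r = x #> \<pi> r" using that relators by (intro run) auto
      then show ?thesis using cosets(1)[OF that(2) one_closed] by (simp add: pi_relator[OF that(1)])
    qed
    show "foldl T K u = K" "foldl T K v = K"
      using run[OF K_in] uv uvK coset_join2[OF _ sub] by simp_all
    show "\<exists>w\<in>carrier ?F. foldl T K w = x" if x: "x \<in> rcosets K" for x
    proof -
      obtain g where g: "g \<in> carrier G" "x = K #> g" using x unfolding RCOSETS_def by blast
      obtain w where "w \<in> carrier ?F" "\<pi> w = g" by (rule pi_surj[OF g(1)])
      then show ?thesis using run[OF K_in] g by blast
    qed
  qed (fact relators deficiency_one uv r0 fin K_in)+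
  moreover have "card (rcosets K) \<ge> 2"
  proof -
    obtain g where g: "g \<in> carrier G" "g \<notin> K" using K(2) K.subset by blast
    then have "K #> g \<noteq> K" using coset_join1[OF _ g(1) sub] by blast
    moreover have "{K, K #> g} \<subseteq> rcosets K" using K_in rcosetsI[OF K.subset g(1)] by simp
    ultimately show ?thesis using card_mono[OF fin, of "{K, K #> g}"] by simp
  qed
  ultimately show ?thesis by (rule large_if_commutator_action)
qed

text \<open>The first Betti number is at least two: \<open>r0\<close> has zero label anyway, so at
  most \<open>n - 2\<close> relators give equations in \<open>n\<close> unknowns, and the condition
  at \<open>h\<close> still leaves a nonzero solution.\<close>

lemma exists_hom_integer:
  assumes h: "h \<in> carrier (free_group_rank n)"
  obtains \<psi> g where "\<psi> \<in> hom G integer_group" "\<psi> (\<pi> h) = 0" "g \<in> carrier G" "\<psi> g \<noteq> 0"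
proof -
  let ?F = "free_group_rank n"
  \<comment> \<open>A graph with one vertex, whose integer labellings are the homomorphisms of the
    free group to the integers.\<close>
  let ?T = "\<lambda>(s :: unit) (l :: nat letter). s"
  interpret A: state_action ?T by unfold_locales simp
  define lab where "lab x = path_label integer_group ?T (\<lambda>_. x) ()" for x
  let ?E = "(\<lambda>w x. lab x w) ` insert h (set R - {r0})"
  have "card ?E \<le> Suc (card (set R - {r0}))"
    by (rule order.trans[OF card_image_le card_insert_le_m1]) auto
  also have "\<dots> \<le> card (set R)"
    using card_Diff1_less[OF finite_set r0(2)] by (simp add: Suc_le_eq)
  also have "\<dots> < n" using card_length[of R] deficiency_one by simp
  finally have card: "card ?E < card {..<n}" by simp
  have lin: "linear_form {..<n} l" if l: "l \<in> ?E" for l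
  proof -
    obtain w where w: "w \<in> carrier ?F" "l = (\<lambda>x. lab x w)" using l relators h by blast
    show ?thesis unfolding w(2) lab_def
      by (rule linear_form_path_label[where A = UNIV and S = "{..<n}"])
        (use w(1) in \<open>auto simp: free_group_def intro: linear_form_proj\<close>)
  qed
  obtain x where x: "\<And>l. l \<in> ?E \<Longrightarrow> l x = 0" "Gcd (x ` {..<n}) = 1"
    by (rule exists_primitive_solution[OF _ _ card lin]) (auto intro: that)
  interpret L: labelled_action integer_group ?T "\<lambda>_. x" by (rule A.labelled_action_int)
  have run: "foldl ?T s w = s" for s w by simp
  have r: "lab x r = 0" if "r \<in> set R" for r
  proof (cases "r = r0")
    case True
    then show ?thesis using L.label_commutator[OF uv r0(1)] by (simp add: lab_def)
  qed (use that x(1) in auto)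
  have mult: "lab x (a \<otimes>\<^bsub>?F\<^esub> b) = lab x a + lab x b" for a b
    using L.label_mult[of "()" "{..<n}" a b] by (simp add: lab_def)
  have ker: "lab x w = 0" if "w \<in> kernel ?F G \<pi>" for w
    using kernel_acts_trivially(2)[OF L.labelled_action_axioms, where A = UNIV and s = "()"] r that
    by (simp add: lab_def)
  define \<sigma> where "\<sigma> = inv_into (carrier ?F) \<pi>"
  have sigma: "\<sigma> g \<in> carrier ?F \<and> \<pi> (\<sigma> g) = g" if "g \<in> carrier G" for g
    using that inv_into_into[of g \<pi> "carrier ?F"] f_inv_into_f[of g \<pi> "carrier ?F"]
    by (simp add: \<sigma>_def surj_pi)
  define \<psi> where "\<psi> g = lab x (\<sigma> g)" for g
  have psi: "\<psi> (\<pi> w) = lab x w" if w: "w \<in> carrier ?F" for w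
  proof -
    note s = sigma[of "\<pi> w"]
    have "\<sigma> (\<pi> w) \<otimes>\<^bsub>?F\<^esub> inv\<^bsub>?F\<^esub> w \<in> kernel ?F G \<pi>"
      using s w by (simp add: kernel_def)
    then have "lab x (\<sigma> (\<pi> w) \<otimes>\<^bsub>?F\<^esub> inv\<^bsub>?F\<^esub> w) + lab x w = lab x w" using ker by simp
    then show ?thesis using s w by (simp add: mult[symmetric] pi.G.m_assoc \<psi>_def)
  qed
  have "\<psi> \<in> hom G integer_group"
  proof (rule homI)
    fix a b assume "a \<in> carrier G" "b \<in> carrier G"
    then obtain w w' where "w \<in> carrier ?F" "\<pi> w = a" "w' \<in> carrier ?F" "\<pi> w' = b"
      using pi_surj by metis
    then show "\<psi> (a \<otimes> b) = \<psi> a \<otimes>\<^bsub>integer_group\<^esub> \<psi> b"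
      using psi[of w] psi[of w'] psi[of "w \<otimes>\<^bsub>?F\<^esub> w'"] by (simp add: mult)
  qed simp
  moreover have "\<psi> (\<pi> h) = 0" using psi[OF h] x(1)[of "\<lambda>x. lab x h"] by simp
  moreover obtain a where a: "a < n" "x a \<noteq> 0"
  proof (rule ccontr)
    assume "\<not> thesis"
    then have "x ` {..<n} \<subseteq> {0}" using that by auto
    then show False using x(2) by (metis Gcd_0_iff zero_neq_one)
  qed
  have aF: "[(a, True)] \<in> carrier ?F" using a by (simp add: free_group_def reduced_Cons)
  then have "\<psi> (\<pi> [(a, True)]) \<noteq> 0" using psi[OF aF] a by (simp add: lab_def edge_label_def)
  ultimately show thesis using that[of \<psi> "\<pi> [(a, True)]"] aF by simp
qed

end

section \<open>Consequences of not being large\<close>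

context commutator_presentation
begin

lemma finite_index_eq_carrier:
  assumes "\<not> large G" "finite_index_subgroup K G" "\<pi> u \<in> K" "\<pi> v \<in> K"
  shows "K = carrier G"
  using large_if_proper_subgroup[OF assms(2) _ assms(3,4)] assms(1) by blast

text \<open>
  The elements acting on the cosets of \<open>K\<close> like an element of the abelian group generated by
  \<open>\<pi> u\<close> and \<open>\<pi> v\<close> form a subgroup of finite index.
\<close>

lemma derived_subset_finite_index:
  assumes not_large: "\<not> large G" and K: "finite_index_subgroup K G"
  shows "derived G (carrier G) \<subseteq> K"
proof -
  have sub: "subgroup K G" and fin: "finite (rcosets K)"
    using K by (auto simp: finite_index_subgroup_def)
  interpret K: subgroup K G by (rule sub)
  let ?A = "generate G {\<pi> u, \<pi> v}"
  have A_sub: "subgroup ?A G" by (rule generate_is_subgroup) simp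
  interpret A: subgroup ?A G by (rule A_sub)
  have A_comm: "h \<otimes> h' = h' \<otimes> h" if "h \<in> ?A" "h' \<in> ?A" for h h'
    by (rule generate_commute[OF _ _ that]) (auto simp: pi_uv_commute)
  note cosets = rcosets_r_coset[OF sub]
  have assoc: "x #> g #> h = x #> (g \<otimes> h)" if "x \<in> rcosets K" "g \<in> carrier G" "h \<in> carrier G" for x g h
    using coset_mult_assoc[OF cosets(1)] that by blast
  define J where "J = {g \<in> carrier G. \<exists>h\<in>?A. \<forall>x\<in>rcosets K. x #> g = x #> h}"
  have J_sub: "subgroup J G"
  proof (rule subgroupI)
    have "\<one> \<in> J" using A.one_closed by (auto simp: J_def)
    then show "J \<noteq> {}" by blast
    fix g assume "g \<in> J"
    then obtain h where h: "g \<in> carrier G" "h \<in> ?A" "\<And>x. x \<in> rcosets K \<Longrightarrow> x #> g = x #> h"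
      by (auto simp: J_def)
    have "x #> inv g = x #> inv h" if x: "x \<in> rcosets K" for x
    proof -
      have "x #> inv g #> h = x #> inv g #> g" using h cosets(2)[OF x, of "inv g"] by simp
      also have "\<dots> = x" using assoc[OF x, of "inv g" g] h cosets(1)[OF x h(1)] by simp
      finally have "x #> inv h = x #> inv g #> h #> inv h" by simp
      also have "\<dots> = x #> inv g"
        using assoc[OF cosets(2)[OF x, of "inv g"], of h "inv h"] h cosets(1)[OF cosets(2)[OF x, of "inv g"], of g]
        by simp
      finally show ?thesis by simp
    qed
    then show "inv g \<in> J" using h unfolding J_def by blast
    fix g' assume "g' \<in> J"
    then obtain h' where h': "g' \<in> carrier G" "h' \<in> ?A" "\<And>x. x \<in> rcosets K \<Longrightarrow> x #> g' = x #> h'"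
      by (auto simp: J_def)
    have "x #> (g \<otimes> g') = x #> (h \<otimes> h')" if x: "x \<in> rcosets K" for x
      using assoc[OF x, of g g'] assoc[OF x, of h h'] h h' x cosets(2)[OF x, of h] by simp
    then show "g \<otimes> g' \<in> J" using h h' unfolding J_def by blast
  qed (auto simp: J_def)
  have "finite (rcosets J)"
  \<comment> \<open>An element is recorded by the graph of its action on the cosets of
    \<open>K\<close>, one of finitely many sets.\<close>
  proof (rule finite_rcosetsI[OF J_sub, where f = "\<lambda>g. (\<lambda>x. (x, x #> g)) ` (rcosets K)"])
    have "(\<lambda>g. (\<lambda>x. (x, x #> g)) ` (rcosets K)) ` carrier G \<subseteq> Pow ((rcosets K) \<times> (rcosets K))"
      using cosets(2) by auto
    then show "finite ((\<lambda>g. (\<lambda>x. (x, x #> g)) ` (rcosets K)) ` carrier G)"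
      using fin by (meson finite_Pow_iff finite_SigmaI finite_subset)
    fix g h assume gh: "g \<in> carrier G" "h \<in> carrier G"
      and eq: "(\<lambda>x. (x, x #> g)) ` (rcosets K) = (\<lambda>x. (x, x #> h)) ` (rcosets K)"
    have "x #> (g \<otimes> inv h) = x #> \<one>" if x: "x \<in> rcosets K" for x
    proof -
      have "x #> g = x #> h" using eq x by blast
      then have "x #> g #> inv h = x #> h #> inv h" by simp
      then show ?thesis using assoc[OF x, of g "inv h"] assoc[OF x, of h "inv h"] gh by simp
    qed
    then show "g \<otimes> inv h \<in> J" using gh A.one_closed unfolding J_def by blast
  qed
  then have "finite_index_subgroup J G" using J_sub by (simp add: finite_index_subgroup_def)
  then have J: "J = carrier G"
    by (rule finite_index_eq_carrier[OF not_large]) (auto simp: J_def intro!: generate.incl)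
  have J_ex: "\<exists>h\<in>?A. \<forall>x\<in>rcosets K. x #> g = x #> h" if "g \<in> carrier G" for g
  proof -
    have "g \<in> J" using that J by simp
    then show ?thesis by (simp add: J_def)
  qed
  \<comment> \<open>On the cosets \<open>g\<close> and \<open>h\<close> act like commuting elements
    of \<open>?A\<close>, so their commutator fixes the coset \<open>K\<close>.\<close>
  have "g \<otimes> h \<otimes> inv g \<otimes> inv h \<in> K" if gh: "g \<in> carrier G" "h \<in> carrier G" for g h
  proof -
    obtain g' where g': "g' \<in> ?A" "\<And>x. x \<in> rcosets K \<Longrightarrow> x #> g = x #> g'"
      using J_ex[OF gh(1)] by blast
    obtain h' where h': "h' \<in> ?A" "\<And>x. x \<in> rcosets K \<Longrightarrow> x #> h = x #> h'"
      using J_ex[OF gh(2)] by blast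
    have K_in: "K \<in> rcosets K" using rcosetsI[OF K.subset one_closed] K.subset by simp
    have "K #> (g \<otimes> h) = K #> (g' \<otimes> h')"
      using assoc[OF K_in, of g h] assoc[OF K_in, of g' h'] g' h' gh K_in cosets(2)[OF K_in, of g'] by simp
    also have "\<dots> = K #> (h' \<otimes> g')" using A_comm g' h' by simp
    also have "\<dots> = K #> (h \<otimes> g)"
      using assoc[OF K_in, of h g] assoc[OF K_in, of h' g'] g' h' gh K_in cosets(2)[OF K_in, of h'] by simp
    finally have "K #> (g \<otimes> h \<otimes> inv (h \<otimes> g)) = K"
      using gh K.subset by (intro coset_mult_inv2) auto
    then have "g \<otimes> h \<otimes> inv (h \<otimes> g) \<in> K" using gh by (intro coset_join1[OF _ _ sub]) auto
    then show ?thesis using gh by (simp add: inv_mult_group m_assoc)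
  qed
  then show ?thesis unfolding derived_def by (intro generate_subgroup_incl sub) auto
qed

text \<open>The preimage of the multiples of a number larger than the absolute value of
  \<open>\<psi> g\<close> has finite index and contains \<open>\<pi> u\<close> and
  \<open>\<pi> v\<close>, so it is all of \<open>G\<close>.\<close>

lemma hom_integer_eq_zero:
  assumes "\<not> large G" "\<psi> \<in> hom G integer_group" "\<psi> (\<pi> u) = 0" "\<psi> (\<pi> v) = 0" "g \<in> carrier G"
  shows "\<psi> g = 0"
proof -
  let ?K = "{h \<in> carrier G. (\<bar>\<psi> g\<bar> + 1) dvd \<psi> h}"
  have "finite_index_subgroup ?K G" by (rule finite_index_dvd[OF assms(2)]) simp
  then have "?K = carrier G" by (rule finite_index_eq_carrier[OF assms(1)]) (use assms(3,4) in auto)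
  then have "(\<bar>\<psi> g\<bar> + 1) dvd \<psi> g" using assms(5) by blast
  then show ?thesis using dvd_imp_le_int[of "\<psi> g" "\<bar>\<psi> g\<bar> + 1"] by linarith
qed

section \<open>The abelianisation and its basis\<close>

abbreviation "ab g \<equiv> derived G (carrier G) #> g"

sublocale AB: comm_group "abelianisation G"
  unfolding abelianisation_def by (rule derived_quot_is_comm_group)

sublocale ab: group_hom G "abelianisation G" ab
  unfolding abelianisation_def
  by (intro group_hom.intro group_hom_axioms.intro derived_quot_is_group
      normal.r_coset_hom_Mod derived_self_is_normal group_axioms)

lemma ab_surj: "ab ` carrier G = carrier (abelianisation G)"
  by (simp add: abelianisation_def carrier_FactGroup)

definition power_uv :: "int \<times> int \<Rightarrow> 'a set" where
  "power_uv p = ab (\<pi> u) [^]\<^bsub>abelianisation G\<^esub> fst p \<otimes>\<^bsub>abelianisation G\<^esub> ab (\<pi> v) [^]\<^bsub>abelianisation G\<^esub> snd p"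

lemma hom_power_uv: "power_uv \<in> hom (integer_group \<times>\<times> integer_group) (abelianisation G)"
proof (rule homI)
  fix p p' :: "int \<times> int"
  show "power_uv (p \<otimes>\<^bsub>integer_group \<times>\<times> integer_group\<^esub> p') = power_uv p \<otimes>\<^bsub>abelianisation G\<^esub> power_uv p'"
    by (simp add: power_uv_def mult_DirProd' AB.int_pow_mult AB.m_ac)
qed (simp add: power_uv_def)

sublocale power_uv: group_hom "integer_group \<times>\<times> integer_group" "abelianisation G" power_uv
  by (intro group_hom.intro group_hom_axioms.intro hom_power_uv DirProd_group AB.group_axioms) simp_all

text \<open>A proper image would lie in a proper finite index subgroup of the finitely generated
  abelian group, whose preimage in \<open>G\<close> would contain \<open>\<pi> u\<close> and
  \<open>\<pi> v\<close>.\<close>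

lemma power_uv_surj:
  assumes "\<not> large G"
  shows "range power_uv = carrier (abelianisation G)"
proof (rule ccontr)
  assume proper: "range power_uv \<noteq> carrier (abelianisation G)"
  have sub: "subgroup (range power_uv) (abelianisation G)"
    using power_uv.img_is_subgroup by simp
  obtain A where A: "finite A" "A \<subseteq> carrier G" "generate G A = carrier G"
    using finitely_generated unfolding finitely_generated_def by blast
  have "generate (abelianisation G) (ab ` A) = carrier (abelianisation G)"
    using ab.generate_img[OF A(2)] by (simp add: A(3) ab_surj)
  moreover have "generate (abelianisation G) (ab ` A) \<subseteq> generate (abelianisation G) (range power_uv \<union> ab ` A)"
    by (rule AB.mono_generate) simp
  moreover have "range power_uv \<union> ab ` A \<subseteq> carrier (abelianisation G)"
    using subgroup.subset[OF sub] A(2) ab.hom_closed by blast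
  then have "generate (abelianisation G) (range power_uv \<union> ab ` A) \<subseteq> carrier (abelianisation G)"
    by (rule AB.generate_incl)
  ultimately have gen: "generate (abelianisation G) (range power_uv \<union> ab ` A) = carrier (abelianisation G)"
    by blast
  have "ab ` A \<subseteq> carrier (abelianisation G)" using A(2) ab.hom_closed by blast
  then obtain K where K: "finite_index_subgroup K (abelianisation G)" "range power_uv \<subseteq> K"
      "K \<noteq> carrier (abelianisation G)"
    using AB.exists_finite_index_subgroup[OF finite_imageI[OF A(1)] _ sub proper gen] by blast
  have uv_range: "ab (\<pi> u) = power_uv (1, 0)" "ab (\<pi> v) = power_uv (0, 1)"
    by (simp_all add: power_uv_def)
  have "finite_index_subgroup {g \<in> carrier G. ab g \<in> K} G"
    using K(1) by (intro ab.finite_index_vimage) (simp_all add: finite_index_subgroup_def)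
  then have "{g \<in> carrier G. ab g \<in> K} = carrier G"
    by (rule finite_index_eq_carrier[OF assms]) (use K(2) uv_range in auto)
  then have "carrier (abelianisation G) \<subseteq> K" unfolding ab_surj[symmetric] by blast
  moreover have "K \<subseteq> carrier (abelianisation G)"
    using K(1) by (simp add: finite_index_subgroup_def subgroup.subset)
  ultimately show False using K(3) by blast
qed

text \<open>\<open>g\<close> differs from the product of powers by an element of the derived
  subgroup, on which \<open>\<psi>\<close> vanishes.\<close>

lemma hom_integer_power_uv:
  assumes psi: "\<psi> \<in> hom G integer_group" and g: "g \<in> carrier G" "ab g = power_uv (i, j)"
  shows "\<psi> g = i * \<psi> (\<pi> u) + j * \<psi> (\<pi> v)"
proof -
  interpret psi: group_hom G integer_group \<psi>
    using psi by (simp add: group_hom_def group_hom_axioms_def group_axioms)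
  let ?h = "\<pi> u [^] i \<otimes> \<pi> v [^] j"
  have "ab ?h = power_uv (i, j)" by (simp add: power_uv_def ab.hom_int_pow)
  then have "g \<in> ab ?h"
    using g rcos_self[OF g(1) derived_is_subgroup[OF subset_refl]] by simp
  then obtain d where d: "d \<in> derived G (carrier G)" "g = d \<otimes> ?h"
    by (auto simp: r_coset_def)
  then have "d \<in> carrier G" using derived_in_carrier[OF subset_refl] by blast
  then have "\<psi> g = \<psi> d + \<psi> ?h" using d(2) by simp
  moreover have "\<psi> d = 0" by (rule hom_integer_derived[OF psi d(1)])
  ultimately show ?thesis by (simp add: psi.hom_int_pow mult.commute)
qed

text \<open>Some nonzero \<open>\<psi>\<close> kills \<open>\<pi> u\<close>, and some nonzero
  \<open>\<psi>\<close> kills \<open>\<pi> v\<close>. As \<open>G\<close> is not large, it cannot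
  kill the other element as well.\<close>

lemma exists_hom_integer_nonzero:
  assumes "\<not> large G" "(i, j) \<noteq> (0 :: int, 0 :: int)"
  obtains \<psi> where "\<psi> \<in> hom G integer_group" "i * \<psi> (\<pi> u) + j * \<psi> (\<pi> v) \<noteq> 0"
proof (cases "j = 0")
  case False
  obtain \<psi> g where psi: "\<psi> \<in> hom G integer_group" "\<psi> (\<pi> u) = 0" "g \<in> carrier G" "\<psi> g \<noteq> 0"
    by (rule exists_hom_integer[OF uv(1)])
  have "\<psi> (\<pi> v) \<noteq> 0" using hom_integer_eq_zero[OF assms(1) psi(1,2) _ psi(3)] psi(4) by blast
  then show thesis using that[OF psi(1)] False psi(2) by simp
next
  case True
  obtain \<psi> g where psi: "\<psi> \<in> hom G integer_group" "\<psi> (\<pi> v) = 0" "g \<in> carrier G" "\<psi> g \<noteq> 0"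
    by (rule exists_hom_integer[OF uv(2)])
  have "\<psi> (\<pi> u) \<noteq> 0" using hom_integer_eq_zero[OF assms(1) psi(1) _ psi(2,3)] psi(4) by blast
  then show thesis using that[OF psi(1)] True assms(2) psi(2) by simp
qed

lemma abelianisation_iso:
  assumes "\<not> large G"
  shows "abelianisation G \<cong> integer_group \<times>\<times> integer_group"
proof -
  \<comment> \<open>Injectivity: a nonzero pair in the kernel would be detected by a homomorphism to
    the integers.\<close>
  have "p = (0, 0)" if p: "power_uv p = \<one>\<^bsub>abelianisation G\<^esub>" for p
  proof (rule ccontr)
    assume "p \<noteq> (0, 0)"
    then obtain \<psi> where psi: "\<psi> \<in> hom G integer_group" "fst p * \<psi> (\<pi> u) + snd p * \<psi> (\<pi> v) \<noteq> 0"
      using exists_hom_integer_nonzero[OF assms, of "fst p" "snd p"] by (cases p) auto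
    have "ab \<one> = power_uv (fst p, snd p)" using p ab.hom_one by simp
    from hom_integer_power_uv[OF psi(1) one_closed this] psi(2) show False
      using hom_integer_derived[OF psi(1) subgroup.one_closed[OF derived_is_subgroup[OF subset_refl]]]
      by simp
  qed
  then have "kernel (integer_group \<times>\<times> integer_group) (abelianisation G) power_uv
      = {\<one>\<^bsub>integer_group \<times>\<times> integer_group\<^esub>}"
    using power_uv.hom_one unfolding kernel_def by force
  then have "inj_on power_uv (carrier (integer_group \<times>\<times> integer_group))"
    by (rule power_uv.trivial_ker_imp_inj)
  then have "power_uv \<in> iso (integer_group \<times>\<times> integer_group) (abelianisation G)"
    using hom_power_uv power_uv_surj[OF assms] by (simp add: iso_def bij_betw_def)
  then have "integer_group \<times>\<times> integer_group \<cong> abelianisation G" by (auto simp: is_iso_def)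
  then show ?thesis by (rule group.iso_sym[OF power_uv.G.group_axioms])
qed

text \<open>From right to left this is residual finiteness of the abelianisation: a nonzero class
  has a nonzero value under some integer homomorphism, and a modulus exceeding that value gives a
  finite index subgroup without \<open>g\<close>.\<close>

lemma derived_eq_Inter:
  assumes "\<not> large G"
  shows "derived G (carrier G) = \<Inter>{H. finite_index_subgroup H G}"
proof
  show "derived G (carrier G) \<subseteq> \<Inter>{H. finite_index_subgroup H G}"
    using derived_subset_finite_index[OF assms] by blast
  show "\<Inter>{H. finite_index_subgroup H G} \<subseteq> derived G (carrier G)"
  proof
    fix g assume g: "g \<in> \<Inter>{H. finite_index_subgroup H G}"
    have "rcosets carrier G \<subseteq> {carrier G}" using coset_join2[OF _ subgroup_self] by (auto simp: RCOSETS_def)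
    then have "finite_index_subgroup (carrier G) G"
      using subgroup_self finite_subset by (auto simp: finite_index_subgroup_def)
    then have gG: "g \<in> carrier G" using g by blast
    obtain p where p: "ab g = power_uv p"
      using power_uv_surj[OF assms] ab.hom_closed[OF gG] by blast
    have "p = (0, 0)"
    proof (rule ccontr)
      assume "p \<noteq> (0, 0)"
      then obtain \<psi> where psi: "\<psi> \<in> hom G integer_group" "fst p * \<psi> (\<pi> u) + snd p * \<psi> (\<pi> v) \<noteq> 0"
        using exists_hom_integer_nonzero[OF assms, of "fst p" "snd p"] by (cases p) auto
      then have "\<psi> g \<noteq> 0" using hom_integer_power_uv[OF psi(1) gG, of "fst p" "snd p"] p by simp
      moreover have "finite_index_subgroup {h \<in> carrier G. (\<bar>\<psi> g\<bar> + 1) dvd \<psi> h} G"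
        by (rule finite_index_dvd[OF psi(1)]) simp
      then have "(\<bar>\<psi> g\<bar> + 1) dvd \<psi> g" using g by blast
      ultimately show False using dvd_imp_le_int[of "\<psi> g" "\<bar>\<psi> g\<bar> + 1"] by linarith
    qed
    then have "ab g = derived G (carrier G)"
      using p power_uv.hom_one by (simp add: abelianisation_def)
    then show "g \<in> derived G (carrier G)"
      using rcos_self[OF gG derived_is_subgroup[OF subset_refl]] by simp
  qed
qed

end

section \<open>From the presentation to the three cases\<close>

lemma (in comm_group) abelianisation_iso_self: "abelianisation G \<cong> G"
  unfolding abelianisation_def derived_eq_singleton[OF subset_refl]
  using trivial_factor_iso by (auto simp: is_iso_def)

text \<open>The surjection is the projection to the quotient followed by an isomorphism onto
  \<open>G\<close>.\<close>

lemma presentation_if_has_presentation: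
  assumes "has_presentation G n R"
  obtains \<pi> where "presentation G n R \<pi>"
proof -
  let ?F = "free_group_rank n"
  let ?N = "normal_closure ?F (set R)"
  have G: "group G" and R: "set R \<subseteq> carrier ?F" and iso: "G \<cong> ?F Mod ?N"
    using assms by (auto simp: has_presentation_def presented_group_def)
  interpret G: group G by (rule G)
  interpret N: normal ?N ?F by (rule normal_normal_closure[OF group_free_group R])
  obtain f where f: "f \<in> iso (?F Mod ?N) G"
    using G.iso_sym[OF iso] by (auto simp: is_iso_def)
  interpret f: group_hom "?F Mod ?N" G f
    using f G N.factorgroup_is_group by (simp add: group_hom_def group_hom_axioms_def iso_def)
  have hom: "(\<lambda>w. f (?N #>\<^bsub>?F\<^esub> w)) \<in> hom ?F G"
    using hom_compose[OF N.r_coset_hom_Mod f.homh] by (simp add: o_def)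
  have surj: "(\<lambda>w. f (?N #>\<^bsub>?F\<^esub> w)) ` carrier ?F = carrier G"
    using f by (simp add: iso_def bij_betw_def carrier_FactGroup image_image)
  have "kernel ?F G (\<lambda>w. f (?N #>\<^bsub>?F\<^esub> w)) = ?N"
  proof -
    have "f (?N #>\<^bsub>?F\<^esub> w) = \<one>\<^bsub>G\<^esub> \<longleftrightarrow> w \<in> ?N" if w: "w \<in> carrier ?F" for w
    proof -
      have inj: "inj_on f (carrier (?F Mod ?N))" using f by (simp add: iso_def bij_betw_def)
      have wN: "?N #>\<^bsub>?F\<^esub> w \<in> carrier (?F Mod ?N)" using w by (simp add: carrier_FactGroup)
      have "f (?N #>\<^bsub>?F\<^esub> w) = \<one>\<^bsub>G\<^esub> \<longleftrightarrow> ?N #>\<^bsub>?F\<^esub> w = ?N"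
        using inj_on_eq_iff[OF inj wN f.G.one_closed] f.hom_one by simp
      also have "\<dots> \<longleftrightarrow> w \<in> ?N"
        using N.coset_join1[OF _ w N.subgroup_axioms] N.coset_join2[OF w N.subgroup_axioms] by blast
      finally show ?thesis .
    qed
    then show ?thesis using N.subset by (auto simp: kernel_def)
  qed
  then have "presentation G n R (\<lambda>w. f (?N #>\<^bsub>?F\<^esub> w))"
    using G R hom surj by (intro presentation.intro presentation_axioms.intro)
  then show thesis by (rule that)
qed

theorem theorem5p5:
  fixes G :: "('a, 'b) monoid_scheme" and n :: nat and R :: "nat letter list list"
  assumes "has_presentation G n R"
    and "deficiency n R = 1"
    and "\<exists>r\<in>set R. is_commutator (free_group_rank n) r"
  shows "(let i = (G \<cong> integer_group \<times>\<times> integer_group);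
              ii = (residually_useless G \<and> abelianisation G \<cong> integer_group \<times>\<times> integer_group);
              iii = large G
          in (i \<or> ii \<or> iii) \<and> \<not> (i \<and> ii) \<and> \<not> (i \<and> iii) \<and> \<not> (ii \<and> iii))
       \<and> (\<not> abelianisation G \<cong> integer_group \<times>\<times> integer_group \<longrightarrow> large G)"
proof -
  obtain \<pi> where "presentation G n R \<pi>" by (rule presentation_if_has_presentation[OF assms(1)])
  then interpret presentation G n R \<pi> .
  obtain r u v where r: "r \<in> set R" "u \<in> carrier (free_group_rank n)" "v \<in> carrier (free_group_rank n)"
    "r = u \<otimes>\<^bsub>free_group_rank n\<^esub> v \<otimes>\<^bsub>free_group_rank n\<^esub> inv\<^bsub>free_group_rank n\<^esub> u \<otimes>\<^bsub>free_group_rank n\<^esub> inv\<^bsub>free_group_rank n\<^esub> v"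
    using assms(3) unfolding is_commutator_def by blast
  interpret commutator_presentation G n R \<pi> u v r
    by unfold_locales (use assms(2) r in \<open>simp_all add: deficiency_def\<close>)
  let ?Z2 = "integer_group \<times>\<times> integer_group"
  have Z2: "comm_group ?Z2"
    by (rule group.group_comm_groupI[OF power_uv.G.group_axioms]) (simp add: mult_DirProd' add.commute)
  have comm: "comm_group G" if "G \<cong> ?Z2"
    using comm_group.iso_imp_comm_group[OF Z2 iso_sym[OF that]] monoid_axioms by blast
  have not_i_ii: "\<not> residually_useless G" if "G \<cong> ?Z2"
    using comm[OF that] by (simp add: residually_useless_def)
  have not_i_iii: "\<not> large G" if "G \<cong> ?Z2"
    by (rule comm_group.not_large[OF comm[OF that]])
  have not_ii_iii: "\<not> large G" if useless: "residually_useless G"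
  proof
    assume "large G"
    then obtain K where "finite_index_subgroup K G" "\<not> derived G (carrier G) \<subseteq> K"
      by (rule large_not_derived_subset)
    then show False using useless by (auto simp: residually_useless_def)
  qed
  \<comment> \<open>Commutativity decides between the two cases: an abelian group is its own
    abelianisation, and otherwise \<open>derived_eq_Inter\<close> applies.\<close>
  have i_or_ii: "G \<cong> ?Z2 \<or> residually_useless G" if not_large: "\<not> large G"
  proof (cases "comm_group G")
    case True
    have "G \<cong> abelianisation G"
      using comm_group.abelianisation_iso_self[OF True] by (rule group.iso_sym[OF AB.group_axioms])
    then show ?thesis using iso_trans abelianisation_iso[OF not_large] by blast
  next
    case False
    then show ?thesis
      using finitely_generated derived_eq_Inter[OF not_large] by (simp add: residually_useless_def)
  qed
  show ?thesis
    unfolding Let_def using not_i_ii not_i_iii not_ii_iii i_or_ii abelianisation_iso by blast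
qed

end
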